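(* Let $(U_i)_{i\ge0}$ be defined by $U_0=1$, $U_1=13$, $U_2=163$ and $U_{i+3}=12U_{i+2}+6U_{i+1}+12U_i$ for all $i\ge0$, and let $\zeta\in\mathbb{Z}_2$ be as defined below. Assume that the lengths of the blocks of zero $2$-adic digits of $\zeta$ satisfy $\ell_\zeta(a)\le\frac{2}{95}a+\frac{18}{5}$ for all $a\ge0$. Then for all $i\ge10$, $$\nu_2(U_i)=\left\lfloor\frac{i-1}{2}\right\rfloor+\begin{cases}\nu_2(i-\zeta)&\text{if } i\equiv1\pmod4,\\0&\text{if } i\not\equiv1\pmod4.\end{cases}$$
   Context: $\nu_2$ is the $2$-adic valuation, $\mathbb{Q}_2,\mathbb{Z}_2$ the $2$-adic numbers and integers, and $\log_2$ the $2$-adic logarithm (given by its usual power series, extended to finite extensions of $\mathbb{Q}_2$). Let $P(x)=x^3-12x^2-6x-12$. It has a unique root $\beta_1\in\mathbb{Z}_2$ with $\beta_1\equiv2\pmod4$; its splitting field $K$ is a quadratic extension of $\mathbb{Q}_2$, and $\beta_2,\beta_3\in K$ denote its other two roots. Let $c_1,c_2,c_3\in K$ be such that $U_i=c_1\beta_1^i+c_2\beta_2^i+c_3\beta_3^i$ for all $i\ge0$. Set $L=\log_2\bigl((\beta_3/\beta_2)^4\bigr)$ and $$\zeta=1+\frac{4}{L}\log_2\!\Bigl(-\frac{c_2\beta_2}{c_3\beta_3}\Bigr),$$ which is a $2$-adic integer. Writing $\zeta=\sum_{i\ge0}d_i2^i$ with $d_i\in\{0,1\}$, $\ell_\zeta(a)$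 is the maximal integer $\ge0$ such that $0=d_a=\cdots=d_{a+\ell_\zeta(a)-1}$. *)

theory Defs
  imports
    "HOL-Algebra.Algebraic_Closure_Type"
    "HOL-Computational_Algebra.Computational_Algebra"
    "HOL-Library.Extended_Real"
    "HOL.Hull"
begin

section \<open>The ring of 2-adic integers\<close>

text \<open>
  The inverse limit of the rings of integers modulo \<open>2 ^ n\<close>: the \<open>n\<close>-th entry of a
  coherent sequence is the representative in \<open>{0..<2 ^ n}\<close> of the residue modulo \<open>2 ^ n\<close>.
\<close>

typedef two_adic_int = "{f :: nat \<Rightarrow> int. \<forall>n. f n = f (Suc n) mod 2 ^ n}"
  morphisms residue Abs_two_adic_int
  by (rule exI[of _ "\<lambda>_. 0"]) simp

setup_lifting type_definition_two_adic_int

lemma residue_coherent: "residue x n = residue x (Suc n) mod 2 ^ n"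
  using residue[of x] by blast

lemma residue_add_mod: "residue x (n + k) mod 2 ^ n = residue x n"
proof (induction k)
  case 0
  have "residue x n mod 2 ^ n = (residue x (Suc n) mod 2 ^ n) mod 2 ^ n"
    by (rule arg_cong[OF residue_coherent])
  also have "\<dots> = residue x (Suc n) mod 2 ^ n" by simp
  also have "\<dots> = residue x n" by (rule residue_coherent[symmetric])
  finally show ?case by simp
next
  case (Suc k)
  have "residue x (n + k) mod 2 ^ n = residue x (n + Suc k) mod 2 ^ n"
    by (subst residue_coherent) (simp add: mod_mod_cancel le_imp_power_dvd)
  with Suc show ?case by simp
qed

lemma residue_mod: "residue x n mod 2 ^ n = residue x n"
  using residue_add_mod[of x n 0] by simp

lemma two_adic_int_eqI: "(\<And>n. residue x n = residue y n) \<Longrightarrow> x = y"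
  by (simp add: residue_inject[symmetric] fun_eq_iff)

lemma mod_pow2_Suc: "(x mod 2 ^ Suc n) mod 2 ^ n = x mod (2 :: int) ^ n"
  by (rule mod_mod_cancel) simp

instantiation two_adic_int :: comm_ring_1
begin

lift_definition zero_two_adic_int :: two_adic_int is "\<lambda>_. 0" by simp

lift_definition one_two_adic_int :: two_adic_int is "\<lambda>n. 1 mod 2 ^ n"
  by (simp only: mod_pow2_Suc)

lift_definition plus_two_adic_int :: "two_adic_int \<Rightarrow> two_adic_int \<Rightarrow> two_adic_int"
  is "\<lambda>x y n. (x n + y n) mod 2 ^ n"
  by (metis mod_pow2_Suc mod_add_eq)

lift_definition times_two_adic_int :: "two_adic_int \<Rightarrow> two_adic_int \<Rightarrow> two_adic_int"
  is "\<lambda>x y n. (x n * y n) mod 2 ^ n"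
  by (metis mod_pow2_Suc mod_mult_eq)

lift_definition uminus_two_adic_int :: "two_adic_int \<Rightarrow> two_adic_int"
  is "\<lambda>x n. (- x n) mod 2 ^ n"
  by (metis mod_pow2_Suc mod_minus_eq)

lift_definition minus_two_adic_int :: "two_adic_int \<Rightarrow> two_adic_int \<Rightarrow> two_adic_int"
  is "\<lambda>x y n. (x n - y n) mod 2 ^ n"
  by (metis mod_pow2_Suc mod_diff_eq)

instance
proof
  fix a b c :: two_adic_int
  show "a + b + c = a + (b + c)" by transfer (simp (no_asm) add: mod_simps algebra_simps)
  show "a + b = b + a" by transfer (simp (no_asm) add: algebra_simps)
  show "0 + a = a" by (rule two_adic_int_eqI)
    (simp only: plus_two_adic_int.rep_eq zero_two_adic_int.rep_eq add_0 residue_mod)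
  show "- a + a = 0" by transfer (simp (no_asm) add: mod_simps)
  show "a - b = a + - b" by transfer (simp (no_asm) add: mod_simps)
  show "a * b * c = a * (b * c)" by transfer (simp (no_asm) add: mod_simps algebra_simps)
  show "a * b = b * a" by transfer (simp (no_asm) add: algebra_simps)
  show "1 * a = a" by (rule two_adic_int_eqI)
    (simp only: times_two_adic_int.rep_eq one_two_adic_int.rep_eq mod_mult_left_eq mult_1 residue_mod)
  show "(a + b) * c = a * c + b * c"
    by transfer (simp (no_asm) add: mod_simps algebra_simps)
  show "(0 :: two_adic_int) \<noteq> 1"
  proof (transfer, rule notI)
    assume "(\<lambda>_. 0) = (\<lambda>n. 1 mod (2 :: int) ^ n)"
    from fun_cong[OF this, of 1] show False by simp
  qed
qed

end

lemma residue_bounds: "0 \<le> residue x n" "residue x n < 2 ^ n"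
  using residue_mod[of x n] by (metis pos_mod_sign pos_mod_bound zero_less_numeral zero_less_power)+

lemma residue_times: "residue (x * y) n = (residue x n * residue y n) mod 2 ^ n"
  by (simp add: times_two_adic_int.rep_eq)

lemma residue_of_nat: "residue (of_nat k) n = int k mod 2 ^ n"
proof (induction k)
  case (Suc k)
  then show ?case
    by (simp add: plus_two_adic_int.rep_eq one_two_adic_int.rep_eq mod_simps)
qed (simp add: zero_two_adic_int.rep_eq)

lemma residue_pow2: "residue (2 ^ k) n = 2 ^ k mod 2 ^ n"
  using residue_of_nat[of "2 ^ k" n] by simp

instance two_adic_int :: idom
proof
  fix a b :: two_adic_int
  assume ab: "a \<noteq> 0" "b \<noteq> 0"
  have "\<exists>n. residue x n \<noteq> 0" if "x \<noteq> 0" for x :: two_adic_int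
    using that two_adic_int_eqI[of x 0] by (auto simp: zero_two_adic_int.rep_eq)
  with ab obtain m k where mk: "residue a m \<noteq> 0" "residue b k \<noteq> 0" by meson
  define A B where "A = residue a (m + k)" and "B = residue b (m + k)"
  have "\<not> 2 ^ m dvd A"
    using mk(1) residue_add_mod[of a m k] by (simp add: A_def dvd_eq_mod_eq_0)
  moreover have "\<not> 2 ^ k dvd B"
    using mk(2) residue_add_mod[of b k m] by (simp add: B_def dvd_eq_mod_eq_0 add.commute)
  ultimately have nz: "A \<noteq> 0" "B \<noteq> 0" and lt: "multiplicity 2 A < m" "multiplicity 2 B < k"
    by (auto simp: not_le[symmetric] intro: multiplicity_dvd')
  have "multiplicity 2 (A * B) < m + k"
    using nz lt by (subst prime_elem_multiplicity_mult_distrib) auto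
  hence "\<not> 2 ^ (m + k) dvd A * B"
    using nz by (subst power_dvd_iff_le_multiplicity) auto
  hence "residue (a * b) (m + k) \<noteq> 0"
    by (simp add: residue_times A_def B_def dvd_eq_mod_eq_0)
  thus "a * b \<noteq> 0" by (auto simp: zero_two_adic_int.rep_eq)
qed

text \<open>The \<open>i\<close>-th digit of the expansion \<open>x = (\<Sum>i. d\<^sub>i * 2 ^ i)\<close> with \<open>d\<^sub>i \<in> {0, 1}\<close>.\<close>

definition digit :: "two_adic_int \<Rightarrow> nat \<Rightarrow> int" where
  "digit x i = residue x (Suc i) div 2 ^ i"

lemma digit_01: "digit x i \<in> {0, 1}"
proof -
  have "0 \<le> digit x i"
    using residue_bounds[of x "Suc i"] by (simp add: digit_def pos_imp_zdiv_nonneg_iff)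
  moreover have "digit x i < 2"
  proof (rule ccontr)
    assume "\<not> digit x i < 2"
    hence "2 * 2 ^ i \<le> digit x i * 2 ^ i" by simp
    also have "\<dots> \<le> residue x (Suc i)"
      unfolding digit_def by (metis div_mult_mod_eq le_add_same_cancel1 pos_mod_sign
          zero_less_numeral zero_less_power)
    finally show False using residue_bounds[of x "Suc i"] by simp
  qed
  ultimately show ?thesis by auto
qed

lemma residue_digits: "residue x n = (\<Sum>i<n. digit x i * 2 ^ i)"
proof (induction n)
  case 0
  show ?case using residue_bounds[of x 0] by simp
next
  case (Suc n)
  have "residue x (Suc n) = residue x (Suc n) div 2 ^ n * 2 ^ n + residue x n"
    unfolding residue_coherent[of x n] by (rule div_mult_mod_eq[symmetric])
  thus ?case using Suc by (simp add: digit_def)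
qed

text \<open>\<open>\<infinity>\<close> iff all digits from position \<open>a\<close> onwards vanish.\<close>

definition zero_block_length :: "two_adic_int \<Rightarrow> nat \<Rightarrow> enat" where
  "zero_block_length x a = (SUP n \<in> {n. \<forall>j<n. digit x (a + j) = 0}. enat n)"

definition nu2 :: "two_adic_int \<Rightarrow> enat" where
  "nu2 x = (SUP n \<in> {n. 2 ^ n dvd x}. enat n)"

lemma pow2_dvd_iff: "(2 :: two_adic_int) ^ n dvd x \<longleftrightarrow> residue x n = 0"
proof
  assume "2 ^ n dvd x"
  thus "residue x n = 0" by (auto simp: residue_times residue_pow2)
next
  assume *: "residue x n = 0"
  define f where "f k = residue x (n + k) div 2 ^ n" for k
  have dvd: "2 ^ n dvd residue x (n + k)" for k
    using residue_add_mod[of x n k] * by (simp add: dvd_eq_mod_eq_0)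
  have f: "2 ^ n * f k = residue x (n + k)" for k
    using dvd[of k] by (simp add: f_def)
  have "f k = f (Suc k) mod 2 ^ k" for k
  proof -
    have "2 ^ n * f k = (2 ^ n * f (Suc k)) mod (2 ^ n * 2 ^ k)"
      unfolding f by (simp add: power_add[symmetric] residue_coherent[of x "n + k"])
    also have "\<dots> = 2 ^ n * (f (Suc k) mod 2 ^ k)" by (rule mult_mod_right[symmetric])
    finally show ?thesis by simp
  qed
  hence res: "residue (Abs_two_adic_int f) = f"
    by (intro Abs_two_adic_int_inverse CollectI allI)
  have "x = 2 ^ n * Abs_two_adic_int f"
  proof (rule two_adic_int_eqI)
    fix k
    have "residue (2 ^ n * Abs_two_adic_int f) k = (2 ^ n * f k) mod 2 ^ k"
      by (simp add: residue_times residue_pow2 res mod_simps)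
    also have "\<dots> = residue x k"
      unfolding f using residue_add_mod[of x k n] by (simp add: add.commute)
    finally show "residue x k = residue (2 ^ n * Abs_two_adic_int f) k" ..
  qed
  thus "2 ^ n dvd x" by (rule dvdI)
qed

lemma two_adic_decomp:
  fixes x :: two_adic_int
  assumes "x \<noteq> 0"
  obtains n u where "x = 2 ^ n * u" "\<not> 2 dvd u"
proof -
  have "\<exists>n. \<not> 2 ^ n dvd x"
    unfolding pow2_dvd_iff using assms two_adic_int_eqI[of x 0]
    by (auto simp: zero_two_adic_int.rep_eq)
  moreover have "\<not> \<not> 2 ^ 0 dvd x" by simp
  ultimately obtain n where n: "\<not> 2 ^ Suc n dvd x" "2 ^ n dvd x"
    using ex_least_nat_less[of "\<lambda>n. \<not> 2 ^ n dvd x"] by blast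
  from n(2) obtain u where u: "x = 2 ^ n * u" by (auto elim: dvdE)
  moreover have "\<not> 2 dvd u" using n(1) u by (auto simp: mult.assoc)
  ultimately show ?thesis by (rule that)
qed

lemma two_adic_odd_mult:
  fixes u v :: two_adic_int
  assumes "\<not> 2 dvd u" "\<not> 2 dvd v"
  shows "\<not> 2 dvd u * v"
proof -
  have odd: "2 dvd x \<longleftrightarrow> even (residue x 1)" for x
    using pow2_dvd_iff[of 1 x] residue_mod[of x 1] by (auto simp: dvd_eq_mod_eq_0)
  have "residue (u * v) 1 = (residue u 1 * residue v 1) mod 2"
    by (simp add: residue_times)
  with assms show ?thesis unfolding odd by (simp add: even_mult_iff dvd_mod_iff)
qed

lemma nu2_decomp:
  fixes u :: two_adic_int
  assumes "\<not> 2 dvd u"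
  shows "nu2 (2 ^ n * u) = enat n"
proof -
  have "2 ^ k dvd 2 ^ n * u \<longleftrightarrow> k \<le> n" for k
  proof
    assume k: "2 ^ k dvd 2 ^ n * u"
    show "k \<le> n"
    proof (rule ccontr)
      assume "\<not> k \<le> n"
      hence "2 ^ Suc n dvd (2 :: two_adic_int) ^ k" by (intro le_imp_power_dvd) simp
      hence "2 ^ n * 2 dvd 2 ^ n * u" using k by (metis dvd_trans power_Suc2)
      moreover have "(2 :: two_adic_int) ^ n \<noteq> 0"
      proof
        assume "(2 :: two_adic_int) ^ n = 0"
        hence "residue (2 ^ n) (Suc n) = residue 0 (Suc n)" by (rule arg_cong)
        thus False unfolding residue_pow2 by (simp add: zero_two_adic_int.rep_eq)
      qed
      ultimately show False using assms by (metis dvd_mult_cancel_left)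
    qed
  next
    assume "k \<le> n"
    thus "2 ^ k dvd 2 ^ n * u" by (meson dvd_mult2 le_imp_power_dvd)
  qed
  hence "nu2 (2 ^ n * u) = (SUP k \<in> {..n}. enat k)" by (simp add: nu2_def atMost_def)
  also have "\<dots> = enat n" by (intro antisym SUP_least SUP_upper) auto
  finally show ?thesis .
qed

lemma nu2_0: "nu2 0 = \<infinity>"
proof -
  have "enat n \<le> nu2 0" for n unfolding nu2_def by (intro SUP_upper) auto
  hence "\<And>n. nu2 0 \<noteq> enat n" by (metis Suc_n_not_le_n enat_ord_simps(1))
  thus ?thesis by (cases "nu2 0") auto
qed

lemma nu2_mult: "nu2 (x * y) = nu2 x + nu2 y"
proof (cases "x = 0 \<or> y = 0")
  case False
  obtain m u where u: "x = 2 ^ m * u" "\<not> 2 dvd u"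
    using two_adic_decomp False by blast
  obtain n v where v: "y = 2 ^ n * v" "\<not> 2 dvd v"
    using two_adic_decomp False by blast
  have "x * y = 2 ^ (m + n) * (u * v)" by (simp add: u v power_add mult_ac)
  hence "nu2 (x * y) = enat (m + n)"
    by (simp only: nu2_decomp two_adic_odd_mult u(2) v(2) not_False_eq_True)
  thus ?thesis by (simp add: u v nu2_decomp)
qed (auto simp: nu2_0)


section \<open>The field of 2-adic numbers and its absolute value\<close>

type_synonym two_adic = "two_adic_int fract"

definition two_adic_int_abs :: "two_adic_int \<Rightarrow> real" where
  "two_adic_int_abs x = (if x = 0 then 0 else (1 / 2) ^ the_enat (nu2 x))"

lemma two_adic_int_abs_mult:
  "two_adic_int_abs (x * y) = two_adic_int_abs x * two_adic_int_abs y"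
proof (cases "x = 0 \<or> y = 0")
  case False
  have *: "\<exists>n. nu2 z = enat n" if "z \<noteq> 0" for z
    using two_adic_decomp[OF that] nu2_decomp by blast
  obtain m n where "nu2 x = enat m" "nu2 y = enat n" using * False by blast
  with False show ?thesis by (simp add: two_adic_int_abs_def nu2_mult power_add)
qed (auto simp: two_adic_int_abs_def)

lemma two_adic_int_abs_eq_0_iff: "two_adic_int_abs x = 0 \<longleftrightarrow> x = 0"
  by (simp add: two_adic_int_abs_def)

definition two_adic_abs :: "two_adic \<Rightarrow> real" where
  "two_adic_abs x =
     (THE r. \<exists>a b. b \<noteq> 0 \<and> x = Fract a b \<and> r = two_adic_int_abs a / two_adic_int_abs b)"

lemma two_adic_abs_Fract:
  assumes "b \<noteq> 0"
  shows "two_adic_abs (Fract a b) = two_adic_int_abs a / two_adic_int_abs b"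
  unfolding two_adic_abs_def
proof (rule the_equality)
  fix r assume "\<exists>c d. d \<noteq> 0 \<and> Fract a b = Fract c d \<and> r = two_adic_int_abs c / two_adic_int_abs d"
  then obtain c d where d: "d \<noteq> 0" "Fract a b = Fract c d"
    and r: "r = two_adic_int_abs c / two_adic_int_abs d" by blast
  hence "a * d = c * b" using assms by (simp add: eq_fract)
  hence "two_adic_int_abs a * two_adic_int_abs d = two_adic_int_abs c * two_adic_int_abs b"
    unfolding two_adic_int_abs_mult[symmetric] by (rule arg_cong)
  thus "r = two_adic_int_abs a / two_adic_int_abs b"
    unfolding r using assms d(1) by (subst frac_eq_eq) (auto simp: two_adic_int_abs_eq_0_iff)
next
  show "\<exists>c d. d \<noteq> 0 \<and> Fract a b = Fract c d \<and>
      two_adic_int_abs a / two_adic_int_abs b = two_adic_int_abs c / two_adic_int_abs d"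
    using assms by (intro exI[of _ a] exI[of _ b]) simp
qed


section \<open>Algebraic extensions of the 2-adic numbers\<close>

definition min_poly :: "'a :: field alg_closure \<Rightarrow> 'a poly" where
  "min_poly x = (THE p. Polynomial.lead_coeff p = 1 \<and> Factorial_Ring.irreducible p \<and>
     poly (map_poly to_ac p) x = 0)"

text \<open>
  The unique extension of the absolute value: up to sign, the constant coefficient of the
  minimal polynomial of \<open>x\<close>, of degree \<open>d\<close>, is the norm of \<open>x\<close> from the field generated
  by \<open>x\<close>, so that its \<open>d\<close>-th root is the absolute value of \<open>x\<close>.
\<close>

definition ac_abs :: "two_adic alg_closure \<Rightarrow> real" where
  "ac_abs x = root (Polynomial.degree (min_poly x)) (two_adic_abs (Polynomial.coeff (min_poly x) 0))"

definition of_two_adic_int :: "two_adic_int \<Rightarrow> two_adic alg_closure" where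
  "of_two_adic_int x = to_ac (Fract x 1)"

definition is_subfield :: "'a :: field set \<Rightarrow> bool" where
  "is_subfield S \<longleftrightarrow> 0 \<in> S \<and> 1 \<in> S \<and>
     (\<forall>x\<in>S. \<forall>y\<in>S. x + y \<in> S \<and> x * y \<in> S) \<and> (\<forall>x\<in>S. - x \<in> S \<and> inverse x \<in> S)"

definition splitting_field :: "'a :: field poly \<Rightarrow> 'a alg_closure set" where
  "splitting_field p = is_subfield hull (range to_ac \<union> {x. poly (map_poly to_ac p) x = 0})"

text \<open>
  The 2-adic logarithm on an extension \<open>K\<close>, as the limit in \<open>K\<close> of the partial sums of the
  series \<open>(\<Sum>k\<ge>1. (-1) ^ (k + 1) * (x - 1) ^ k / k)\<close>. For finite \<open>K\<close> this is meaningful for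
  \<open>x \<in> K\<close> with \<open>ac_abs (x - 1) < 1\<close>, and unspecified elsewhere.
\<close>

definition log2_adic :: "two_adic alg_closure set \<Rightarrow> two_adic alg_closure \<Rightarrow> two_adic alg_closure"
  where
  "log2_adic K x = (THE y. y \<in> K \<and>
     (\<lambda>n. ac_abs (y - (\<Sum>k=1..n. (- 1) ^ (k + 1) * (x - 1) ^ k / of_nat k))) \<longlonglongrightarrow> 0)"

definition cubic :: "'a :: comm_ring_1 poly" where
  "cubic = [:- 12, - 6, - 12, 1:]"

end

theory Submission
  imports Defs
begin

text \<open>
  The cubic factors over the 2-adic integers as a linear factor with root \<open>\<beta>1\<close> and a quadratic
  factor generating \<open>K = Q\<^sub>2(\<delta>)\<close> with \<open>\<delta>\<^sup>2 \<equiv> 3\<close> modulo 4, so that \<open>Z\<^sub>2[\<delta>]\<close> is the unit ball of the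
  absolute value. For \<open>i = 4 * k + 1\<close> put \<open>x = (\<beta>3 / \<beta>2)\<^sup>4\<close> and \<open>y = - c2 * \<beta>2 / (c3 * \<beta>3)\<close>. Then
  \<open>c2 * \<beta>2\<^sup>i + c3 * \<beta>3\<^sup>i = c3 * \<beta>3 * \<beta>2 ^ (4 * k) * (x\<^sup>k - y)\<close>. Both \<open>x\<close> and \<open>y\<close> are congruent to 1
  modulo 4, where the logarithm is an isometric homomorphism, so the power of 2 in \<open>x\<^sup>k - y\<close> is that
  in \<open>k * log x - log y = log x * (i - \<zeta>) / 4\<close>. The remaining term \<open>c1 * \<beta>1\<^sup>i\<close> has valuation \<open>i - 1\<close>,
  and it does not interfere because a high power of 2 dividing \<open>i - \<zeta>\<close> forces a long block of zero
  digits of \<open>\<zeta>\<close>; only \<open>i = 13\<close> and \<open>i = 17\<close> escape this bound and are computed. For \<open>i\<close> not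
  congruent to 1 modulo 4 the recurrence alone gives the valuation by induction.
\<close>

section \<open>Divisibility in the 2-adic integers\<close>

lemma two_dvd_cases: "2 dvd x \<or> 2 dvd x - 1" for x :: two_adic_int
proof -
  have "residue x 1 \<in> {0, 1}" using residue_bounds[of x 1] by auto
  moreover have "residue (x - 1) 1 = (residue x 1 - 1) mod 2"
    by (simp add: minus_two_adic_int.rep_eq one_two_adic_int.rep_eq mod_simps)
  ultimately show ?thesis
    using pow2_dvd_iff[of 1 x] pow2_dvd_iff[of 1 "x - 1"] by auto
qed

lemma not_two_dvd_1: "\<not> (2 :: two_adic_int) dvd 1"
  using pow2_dvd_iff[of 1 1] by (simp add: one_two_adic_int.rep_eq)

lemma odd_two_adic_int_iff: "\<not> 2 dvd x \<longleftrightarrow> 2 dvd x - 1" for x :: two_adic_int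
  using two_dvd_cases[of x] not_two_dvd_1 dvd_diff[of 2 x "x - 1"] by auto

lemma odd_two_adic_intI: "\<not> 2 dvd 1 + 2 * (x :: two_adic_int)"
  by (simp add: odd_two_adic_int_iff)

lemma odd_two_adic_intE:
  fixes x :: two_adic_int
  assumes "\<not> 2 dvd x"
  obtains y where "x = 1 + 2 * y"
  using assms unfolding odd_two_adic_int_iff by (metis add.commute diff_add_cancel dvdE)

lemma residue_of_int: "residue (of_int a) n = a mod 2 ^ n"
proof (cases a)
  case (nonneg k)
  thus ?thesis by (simp add: residue_of_nat)
next
  case (neg k)
  have "residue (- of_nat (Suc k)) n = (- int (Suc k)) mod 2 ^ n"
    by (simp only: uminus_two_adic_int.rep_eq residue_of_nat mod_minus_eq)
  thus ?thesis using neg by simp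
qed

lemma pow2_dvd_of_int: "(2 :: two_adic_int) ^ n dvd of_int a \<longleftrightarrow> 2 ^ n dvd a"
  by (simp add: pow2_dvd_iff residue_of_int dvd_eq_mod_eq_0)

lemma of_nat_two_adic_eq_0_iff: "(of_nat k :: two_adic_int) = 0 \<longleftrightarrow> k = 0"
proof
  assume "(of_nat k :: two_adic_int) = 0"
  hence "int k mod 2 ^ k = 0"
    by (metis residue_of_nat zero_two_adic_int.rep_eq)
  moreover have "int k < 2 ^ k" using of_nat_less_two_power by blast
  ultimately show "k = 0" by simp
qed simp

lemma two_adic_2_neq_0: "(2 :: two_adic_int) \<noteq> 0"
  using of_nat_two_adic_eq_0_iff[of 2] by simp

lemma pow2_dvd_all_imp_0:
  assumes "\<And>n. (2 :: two_adic_int) ^ n dvd x"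
  shows "x = 0"
  using assms by (intro two_adic_int_eqI) (simp add: pow2_dvd_iff zero_two_adic_int.rep_eq)

lemma residue_eq_iff: "residue x n = residue y n \<longleftrightarrow> 2 ^ n dvd x - y"
proof -
  have "residue x n = residue y n \<longleftrightarrow> residue x n mod 2 ^ n = residue y n mod 2 ^ n"
    by (simp only: residue_mod)
  thus ?thesis
    by (simp add: pow2_dvd_iff minus_two_adic_int.rep_eq mod_eq_dvd_iff dvd_eq_mod_eq_0)
qed

text \<open>The diagonal sequence taking the \<open>n\<close>-th residue of \<open>s n\<close> is
  coherent, so it is itself the limit. Inverses of odd numbers and logarithms are both obtained this
  way.\<close>

lemma two_adic_int_complete:
  assumes "\<And>n. 2 ^ n dvd s (Suc n) - (s n :: two_adic_int)"
  obtains l where "\<And>n. 2 ^ n dvd l - s n"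
proof -
  define f where "f n = residue (s n) n" for n
  have "f n = f (Suc n) mod 2 ^ n" for n
    using assms[of n] by (simp add: f_def residue_eq_iff[symmetric] residue_coherent[symmetric])
  hence "residue (Abs_two_adic_int f) = f"
    by (intro Abs_two_adic_int_inverse CollectI allI)
  hence "2 ^ n dvd Abs_two_adic_int f - s n" for n
    by (simp add: residue_eq_iff[symmetric] f_def)
  thus ?thesis by (rule that)
qed

lemma two_adic_odd_power: "\<not> 2 dvd x \<Longrightarrow> \<not> 2 dvd x ^ n" for x :: two_adic_int
  by (induction n) (simp_all add: not_two_dvd_1 two_adic_odd_mult)

text \<open>\<open>x ^ 2 ^ Suc n - 1\<close> has the factors \<open>x ^ 2 ^ n - 1\<close> and
  \<open>x ^ 2 ^ n + 1\<close>, and the second is even.\<close>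

lemma odd_power_pow2:
  fixes x :: two_adic_int
  assumes "\<not> 2 dvd x"
  shows "2 ^ n dvd x ^ 2 ^ n - 1"
proof (induction n)
  case (Suc n)
  obtain y where y: "x ^ 2 ^ n = 1 + 2 * y"
    using two_adic_odd_power[OF assms] by (rule odd_two_adic_intE)
  have "x ^ 2 ^ Suc n - 1 = (x ^ 2 ^ n) ^ 2 - 1"
    by (simp only: power_Suc2 power_mult)
  also have "\<dots> = 2 * (x ^ 2 ^ n - 1) * (1 + y)"
    unfolding y by (simp add: power2_eq_square algebra_simps)
  also have "2 ^ Suc n dvd \<dots>"
    unfolding power_Suc by (intro dvd_mult2 mult_dvd_mono dvd_refl Suc)
  finally show ?case .
qed simp

text \<open>Multiplying \<open>x ^ (2 ^ n - 1)\<close> by \<open>x\<close> gives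
  \<open>x ^ 2 ^ n\<close>, which tends to 1; so these powers converge to the inverse of
  \<open>x\<close>.\<close>

lemma odd_two_adic_int_unit:
  fixes x :: two_adic_int
  assumes "\<not> 2 dvd x"
  obtains y where "x * y = 1"
proof -
  define s where "s n = x ^ (2 ^ n - 1)" for n
  have xs: "x * s n = x ^ 2 ^ n" for n
    by (simp add: s_def power_Suc[symmetric] del: power_Suc)
  have "s (Suc n) - s n = s n * (x ^ 2 ^ n - 1)" for n
  proof -
    have "(2::nat) ^ Suc n - 1 = (2 ^ n - 1) + 2 ^ n"
      using one_le_power[of "2::nat" n] by simp
    hence "s (Suc n) = x ^ ((2 ^ n - 1) + 2 ^ n)" by (simp only: s_def)
    thus ?thesis by (simp only: s_def power_add) (simp add: algebra_simps)
  qed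
  hence "2 ^ n dvd s (Suc n) - s n" for n
    using odd_power_pow2[OF assms, of n] by simp
  then obtain l where l: "\<And>n. 2 ^ n dvd l - s n"
    using two_adic_int_complete by blast
  have "2 ^ n dvd x * l - 1" for n
  proof -
    have "x * l - 1 = x * (l - s n) + (x ^ 2 ^ n - 1)"
      using xs[of n] by (simp add: algebra_simps)
    thus ?thesis
      by (simp only: dvd_add dvd_mult l odd_power_pow2[OF assms])
  qed
  hence "x * l - 1 = 0" by (rule pow2_dvd_all_imp_0)
  thus ?thesis by (intro that[of l]) simp
qed

lemma pow2_dvd_mult_odd:
  fixes x u :: two_adic_int
  assumes "\<not> 2 dvd u"
  shows "2 ^ n dvd x * u \<longleftrightarrow> 2 ^ n dvd x"
proof
  assume *: "2 ^ n dvd x * u"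
  obtain v where "u * v = 1" using odd_two_adic_int_unit[OF assms] .
  hence "x = x * u * v" by (simp add: mult.assoc)
  thus "2 ^ n dvd x" using * by (metis dvd_mult2)
qed simp

lemma pow2_dvd_pow2_mult_odd_iff:
  fixes v :: two_adic_int
  assumes "\<not> 2 dvd v"
  shows "2 ^ k dvd 2 ^ n * v \<longleftrightarrow> k \<le> n"
proof -
  have "2 ^ k dvd 2 ^ n * v \<longleftrightarrow> (2 :: two_adic_int) ^ k dvd of_int (2 ^ n)"
    by (simp add: pow2_dvd_mult_odd[OF assms])
  also have "\<dots> \<longleftrightarrow> (2 :: int) ^ k dvd 2 ^ n" by (rule pow2_dvd_of_int)
  finally show ?thesis by (simp add: dvd_power_iff)
qed

text \<open>The odd part of \<open>k\<close> is a unit and the exponent of 2 in \<open>k\<close> is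
  below \<open>k\<close>. This makes \<open>2 ^ k / k\<close> integral and so controls the
  denominators of the logarithm series.\<close>

lemma of_nat_dvd_pow2:
  assumes "k > 0"
  shows "(of_nat k :: two_adic_int) dvd 2 ^ k"
proof -
  obtain a m where am: "k = 2 ^ a * m" "odd m"
    using multiplicity_decompose'[of k 2] assms by (metis mult.commute not_is_unit_0 odd_one not_gr_zero)
  have "\<not> 2 dvd (of_nat m :: two_adic_int)"
    using am(2) pow2_dvd_of_int[of 1 "int m"] by simp
  then obtain v where v: "(of_nat m :: two_adic_int) * v = 1" using odd_two_adic_int_unit by blast
  have "a < 2 ^ a" by (rule less_exp)
  also have "\<dots> \<le> k" using am by (cases m) auto
  finally have "2 ^ k = (2 :: two_adic_int) ^ a * 2 ^ (k - a)" by (simp flip: power_add)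
  also have "\<dots> = of_nat k * (v * 2 ^ (k - a))" using v by (simp add: am(1) mult_ac) 
  finally show ?thesis by (rule dvdI)
qed

section \<open>Minimal polynomials over the 2-adic numbers\<close>

lemma of_two_adic_int_simps [simp]:
  "of_two_adic_int 0 = 0" "of_two_adic_int 1 = 1"
  "of_two_adic_int (x + y) = of_two_adic_int x + of_two_adic_int y"
  "of_two_adic_int (x - y) = of_two_adic_int x - of_two_adic_int y"
  "of_two_adic_int (- x) = - of_two_adic_int x"
  "of_two_adic_int (x * y) = of_two_adic_int x * of_two_adic_int y"
  by (simp_all add: of_two_adic_int_def Zero_fract_def[symmetric] One_fract_def[symmetric]
      flip: to_ac_add to_ac_diff to_ac_minus to_ac_mult)

lemma of_two_adic_int_power [simp]: "of_two_adic_int (x ^ n) = of_two_adic_int x ^ n"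
  by (induction n) simp_all

lemma of_two_adic_int_of_nat [simp]: "of_two_adic_int (of_nat n) = of_nat n"
  by (induction n) simp_all

lemma of_two_adic_int_numeral [simp]: "of_two_adic_int (numeral n) = numeral n"
  using of_two_adic_int_of_nat[of "numeral n"] by (simp del: of_two_adic_int_of_nat)

lemma of_two_adic_int_of_int [simp]: "of_two_adic_int (of_int a) = of_int a"
  by (cases a) (simp_all del: of_nat_Suc)

lemma of_two_adic_int_eq_iff [simp]: "of_two_adic_int x = of_two_adic_int y \<longleftrightarrow> x = y"
  by (simp add: of_two_adic_int_def eq_fract)

lemma of_two_adic_int_eq_0_iff [simp]: "of_two_adic_int x = 0 \<longleftrightarrow> x = 0"
  using of_two_adic_int_eq_iff[of x 0] by (simp del: of_two_adic_int_eq_iff)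

lemma ac_of_nat_eq_0_iff [simp]: "(of_nat n :: two_adic alg_closure) = 0 \<longleftrightarrow> n = 0"
  using of_two_adic_int_eq_0_iff[of "of_nat n"] by (simp add: of_nat_two_adic_eq_0_iff)

lemma ac_numeral_neq_0 [simp]: "(numeral n :: two_adic alg_closure) \<noteq> 0"
  using ac_of_nat_eq_0_iff[of "numeral n"] by simp

text \<open>The odd part of a denominator is a unit and can be moved to the numerator.\<close>

lemma to_ac_eq_divide_pow2:
  obtains n a where "to_ac x = of_two_adic_int a / 2 ^ n"
proof (cases x)
  case (Fract a b)
  then obtain n v where v: "b = 2 ^ n * v" "\<not> 2 dvd v" using two_adic_decomp by blast
  obtain w where w: "v * w = 1" using odd_two_adic_int_unit[OF v(2)] .
  have "x = Fract a 1 / Fract b 1" using Fract by simp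
  hence "to_ac x = of_two_adic_int a / of_two_adic_int b"
    by (simp only: of_two_adic_int_def to_ac_divide)
  also have "\<dots> = of_two_adic_int (a * w) / 2 ^ n"
  proof -
    have "of_two_adic_int a * 2 ^ n = of_two_adic_int (a * w) * of_two_adic_int b"
      unfolding v(1) of_two_adic_int_numeral[symmetric] of_two_adic_int_power[symmetric]
        of_two_adic_int_simps(6)[symmetric] using w by (simp add: algebra_simps del: of_two_adic_int_simps)
    thus ?thesis using Fract by (simp add: frac_eq_eq)
  qed
  finally show ?thesis by (rule that)
qed

lemma poly_map_to_ac_add:
  "poly (map_poly to_ac (p + q)) z = poly (map_poly to_ac p) z + poly (map_poly to_ac q) z"
proof (induction p arbitrary: q)
  case (pCons a p)
  obtain b r where q: "q = pCons b r" by (rule pCons_cases)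
  show ?case unfolding q by (simp add: map_poly_pCons pCons.IH algebra_simps)
qed simp

lemma poly_map_to_ac_smult:
  "poly (map_poly to_ac (smult c p)) z = to_ac c * poly (map_poly to_ac p) z"
  by (induction p) (simp_all add: map_poly_pCons algebra_simps)

lemma poly_map_to_ac_mult:
  "poly (map_poly to_ac (p * q)) z = poly (map_poly to_ac p) z * poly (map_poly to_ac q) z"
  by (induction p)
    (simp_all add: map_poly_pCons poly_map_to_ac_add poly_map_to_ac_smult algebra_simps)

text \<open>By division with remainder, an annihilator \<open>m\<close> of \<open>z\<close> of least
  degree divides all others. Irreducible annihilators are therefore associated with
  \<open>m\<close>, and only one of them is monic.\<close>

lemma min_poly_eqI:
  fixes p :: "'a :: field poly"
  assumes monic: "Polynomial.lead_coeff p = 1" and irred: "Factorial_Ring.irreducible p"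
    and root: "poly (map_poly to_ac p) z = 0"
  shows "min_poly z = p"
  unfolding min_poly_def
proof (rule the_equality)
  fix q :: "'a poly"
  assume q: "Polynomial.lead_coeff q = 1 \<and> Factorial_Ring.irreducible q \<and> poly (map_poly to_ac q) z = 0"
  define P where "P r \<longleftrightarrow> r \<noteq> 0 \<and> poly (map_poly to_ac r) z = 0" for r :: "'a poly"
  have "P p" using root irred by (auto simp: P_def)
  then obtain m where m: "P m" "\<And>r. P r \<Longrightarrow> Polynomial.degree m \<le> Polynomial.degree r"
    using ex_has_least_nat[of P p Polynomial.degree] by blast
  have dvd: "m dvd r" if "poly (map_poly to_ac r) z = 0" for r
  proof (rule ccontr)
    assume "\<not> m dvd r"
    hence nz: "r mod m \<noteq> 0" by (simp add: dvd_eq_mod_eq_0)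
    have "poly (map_poly to_ac (m * (r div m) + r mod m)) z = 0"
      by (simp only: mult_div_mod_eq that)
    hence "P (r mod m)"
      using m(1) nz unfolding P_def poly_map_to_ac_add poly_map_to_ac_mult by simp
    with m(2) have "Polynomial.degree m \<le> Polynomial.degree (r mod m)" by blast
    thus False using degree_mod_less[of m r] m(1) nz by (auto simp: P_def)
  qed
  have "\<not> is_unit m"
  proof
    assume "is_unit m"
    then obtain c where "m = [:c:]" "c \<noteq> 0" by (auto simp: is_unit_poly_iff dvd_field_iff)
    thus False using m(1) by (simp add: P_def map_poly_pCons)
  qed
  hence assoc: "r dvd m" if "Factorial_Ring.irreducible r" "poly (map_poly to_ac r) z = 0" for r
    using that dvd[of r] by (meson irreducible_altdef)
  have "p dvd q" "q dvd p"
    using assoc[of p] assoc[of q] dvd[of p] dvd[of q] q irred root by (meson dvd_trans)+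
  moreover from this obtain r where r: "q = p * r" by (elim dvdE)
  ultimately have "Polynomial.degree r = 0"
    using q irred by (metis add_left_cancel add.right_neutral antisym degree_mult_eq dvd_imp_degree_le not_irreducible_zero mult_zero_left mult_zero_right)
  then obtain c where "r = [:c:]" by (rule degree_eq_zeroE)
  thus "q = p" using q monic r by (cases "c = 0") auto
qed (use assms in simp)

text \<open>A proper factorisation would have two linear factors, one of them vanishing at
  \<open>z\<close>, which would put \<open>z\<close> into the base field.\<close>

lemma degree_2_irreducibleI:
  fixes p :: "'a :: field poly"
  assumes "Polynomial.degree p = 2" "poly (map_poly to_ac p) z = 0" "z \<notin> range to_ac"
  shows "Factorial_Ring.irreducible p"
proof (rule irreducibleI)
  have deg1: "poly (map_poly to_ac q) z \<noteq> 0" if deg: "Polynomial.degree q = 1" for q :: "'a poly"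
  proof
    assume root: "poly (map_poly to_ac q) z = 0"
    obtain a b where q: "q = [:a, b:]" "b \<noteq> 0" using deg by (rule degree1_coeffs)
    hence "z * to_ac b = - to_ac a" using root by (simp add: map_poly_pCons add_eq_0_iff2)
    hence "z = to_ac (- a / b)"
      using q(2) by (metis nonzero_mult_div_cancel_right to_ac_divide to_ac_eq_0_iff to_ac_minus)
    thus False using assms(3) by blast
  qed
  fix q r assume qr: "p = q * r"
  show "is_unit q \<or> is_unit r"
  proof (rule ccontr)
    assume "\<not> (is_unit q \<or> is_unit r)"
    moreover have nz: "q \<noteq> 0" "r \<noteq> 0" using qr assms(1) by auto
    ultimately have "Polynomial.degree q \<noteq> 0" "Polynomial.degree r \<noteq> 0"
      by (auto simp: is_unit_iff_degree)
    moreover have "Polynomial.degree q + Polynomial.degree r = 2"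
      using assms(1) nz by (simp add: qr degree_mult_eq)
    ultimately have "Polynomial.degree q = 1" "Polynomial.degree r = 1" by linarith+
    thus False using deg1[of q] deg1[of r] assms(2) by (simp add: qr poly_map_to_ac_mult)
  qed
qed (use assms(1) in \<open>auto simp: is_unit_poly_iff\<close>)

section \<open>A ramified quadratic extension\<close>

locale quadratic_extension =
  fixes \<delta> :: "two_adic alg_closure" and u :: two_adic_int
  assumes \<delta>_square: "\<delta> ^ 2 = of_two_adic_int u"
    and u_mod_4: "4 dvd u - 3"
begin

definition elt :: "two_adic_int \<Rightarrow> two_adic_int \<Rightarrow> two_adic alg_closure" where
  "elt a b = of_two_adic_int a + of_two_adic_int b * \<delta>"

definition OK :: "two_adic alg_closure set" where
  "OK = {elt a b | a b. True}"

text \<open>Divisibility by \<open>2 ^ n\<close> in the ring \<open>OK = Z\<^sub>2[\<delta>]\<close>, not in the field.\<close>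

definition pdvd :: "nat \<Rightarrow> two_adic alg_closure \<Rightarrow> bool" where
  "pdvd n z \<longleftrightarrow> (\<exists>w\<in>OK. z = 2 ^ n * w)"

lemma elt_in_OK [simp, intro]: "elt a b \<in> OK" by (auto simp: OK_def)

lemma elt_add: "elt a b + elt c d = elt (a + c) (b + d)"
  by (simp add: elt_def algebra_simps)

lemma elt_diff: "elt a b - elt c d = elt (a - c) (b - d)"
  by (simp add: elt_def algebra_simps)

lemma elt_minus: "- elt a b = elt (- a) (- b)"
  by (simp add: elt_def)

lemma elt_mult: "elt a b * elt c d = elt (a * c + u * b * d) (a * d + b * c)"
proof -
  have "\<delta> * \<delta> = of_two_adic_int u"
    by (simp flip: \<delta>_square add: power2_eq_square)
  thus ?thesis by (simp add: elt_def algebra_simps)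
qed

lemma elt_conj_mult: "elt a b * elt a (- b) = of_two_adic_int (a\<^sup>2 - u * b\<^sup>2)"
  unfolding elt_mult by (simp add: elt_def power2_eq_square algebra_simps)

lemma of_two_adic_int_eq_elt: "of_two_adic_int a = elt a 0"
  by (simp add: elt_def)

lemma of_in_OK [simp, intro]: "of_two_adic_int a \<in> OK"
  by (simp add: of_two_adic_int_eq_elt)

lemma OK_closed [simp, intro]:
  shows OK_0: "0 \<in> OK" and OK_1: "1 \<in> OK" and OK_numeral: "numeral n \<in> OK"
    and OK_of_nat: "of_nat k \<in> OK" and OK_of_int: "of_int j \<in> OK"
    and OK_add: "x \<in> OK \<Longrightarrow> y \<in> OK \<Longrightarrow> x + y \<in> OK"
    and OK_diff: "x \<in> OK \<Longrightarrow> y \<in> OK \<Longrightarrow> x - y \<in> OK"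
    and OK_minus: "x \<in> OK \<Longrightarrow> - x \<in> OK"
    and OK_mult: "x \<in> OK \<Longrightarrow> y \<in> OK \<Longrightarrow> x * y \<in> OK"
proof -
  show "0 \<in> OK" "1 \<in> OK" "numeral n \<in> OK" "of_nat k \<in> OK" "of_int j \<in> OK"
    using of_in_OK[of 0] of_in_OK[of 1] of_in_OK[of "numeral n"] of_in_OK[of "of_nat k"]
      of_in_OK[of "of_int j"] by simp_all
  have 2: "\<And>P x. \<lbrakk>x \<in> OK; \<And>a b. P (elt a b)\<rbrakk> \<Longrightarrow> P x" by (auto simp: OK_def)
  show "- x \<in> OK" if "x \<in> OK" using that by (rule 2) (simp add: elt_minus)
  assume xy: "x \<in> OK" "y \<in> OK"
  show "x + y \<in> OK" "x - y \<in> OK" "x * y \<in> OK"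
    by (rule 2[OF xy(1)]; rule 2[OF xy(2)]; simp add: elt_add elt_diff elt_mult)+
qed

lemma OK_power [simp, intro]: "x \<in> OK \<Longrightarrow> x ^ n \<in> OK"
  by (induction n) auto

lemma OK_sum [intro]: "(\<And>i. i \<in> A \<Longrightarrow> f i \<in> OK) \<Longrightarrow> sum f A \<in> OK"
  by (induction A rule: infinite_finite_induct) auto

lemma pdvd_0_iff: "pdvd 0 z \<longleftrightarrow> z \<in> OK" by (simp add: pdvd_def)

lemma pdvd_zero [simp, intro]: "pdvd n 0" by (auto simp: pdvd_def intro: bexI[of _ 0])

lemma pdvd_imp_OK: "pdvd n z \<Longrightarrow> z \<in> OK" by (auto simp: pdvd_def)

lemma pdvd_add: "pdvd n x \<Longrightarrow> pdvd n y \<Longrightarrow> pdvd n (x + y)"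
  by (auto simp: pdvd_def simp flip: distrib_left)

lemma pdvd_diff: "pdvd n x \<Longrightarrow> pdvd n y \<Longrightarrow> pdvd n (x - y)"
  by (auto simp: pdvd_def simp flip: right_diff_distrib)

lemma pdvd_mult: "pdvd m x \<Longrightarrow> pdvd n y \<Longrightarrow> pdvd (m + n) (x * y)"
proof -
  assume "pdvd m x" "pdvd n y"
  then obtain v w where "v \<in> OK" "w \<in> OK" "x = 2 ^ m * v" "y = 2 ^ n * w"
    by (auto simp: pdvd_def)
  hence "v * w \<in> OK" "x * y = 2 ^ (m + n) * (v * w)" by (simp_all add: power_add mult_ac)
  thus "pdvd (m + n) (x * y)" by (auto simp: pdvd_def)
qed

lemma pdvd_mult_OK: "pdvd m x \<Longrightarrow> y \<in> OK \<Longrightarrow> pdvd m (x * y)"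
  using pdvd_mult[of m x 0 y] by (simp add: pdvd_0_iff)

lemma pdvd_mono: "pdvd n x \<Longrightarrow> m \<le> n \<Longrightarrow> pdvd m x"
proof -
  assume "pdvd n x" "m \<le> n"
  then obtain w where "w \<in> OK" "x = 2 ^ n * w" by (auto simp: pdvd_def)
  hence "x = 2 ^ m * (2 ^ (n - m) * w)" "2 ^ (n - m) * w \<in> OK"
    using \<open>m \<le> n\<close> by (simp_all add: mult.assoc[symmetric] flip: power_add)
  thus "pdvd m x" by (auto simp: pdvd_def)
qed

lemma pdvd_pow2_mult: "pdvd (m + n) (2 ^ m * z) \<longleftrightarrow> pdvd n z"
  by (simp add: pdvd_def power_add mult.assoc)

lemma pdvd_sum: "(\<And>i. i \<in> A \<Longrightarrow> pdvd n (f i)) \<Longrightarrow> pdvd n (sum f A)"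
  by (induction A rule: infinite_finite_induct) (auto intro: pdvd_add)

text \<open>As \<open>u\<close> is 3 modulo 4, the norm is odd when exactly one of \<open>a\<close>
  and \<open>b\<close> is odd, and it is 2 modulo 4 when both are odd.\<close>

lemma norm_form_divisible_by_4:
  assumes "4 dvd a\<^sup>2 - u * b\<^sup>2"
  shows "2 dvd a \<and> 2 dvd b"
proof -
  have two: "2 dvd x" if "4 dvd x" for x :: two_adic_int
    using that dvd_trans[of 2 4 x] by (metis dvd_triv_left mult_2 numeral_Bit0 one_add_one)
  obtain v where v: "u = 3 + 4 * v" using u_mod_4 by (metis dvdE diff_add_cancel add.commute)
  consider (ee) "2 dvd a" "2 dvd b" | (eo) "2 dvd a" "\<not> 2 dvd b" | (oe) "\<not> 2 dvd a" "2 dvd b"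
    | (oo) "\<not> 2 dvd a" "\<not> 2 dvd b" by blast
  thus ?thesis
  proof cases
    case eo
    then obtain c d where "a = 2 * c" "b = 1 + 2 * d" by (metis dvdE odd_two_adic_intE)
    hence "a\<^sup>2 - u * b\<^sup>2 = 1 + 2 * (2 * c\<^sup>2 - 2 - 2 * v - (3 + 4 * v) * (2 * d + 2 * d\<^sup>2))"
      by (simp add: v power2_eq_square algebra_simps)
    thus ?thesis using two[OF assms] odd_two_adic_intI by metis
  next
    case oe
    then obtain c d where "b = 2 * c" "a = 1 + 2 * d" by (metis dvdE odd_two_adic_intE)
    hence "a\<^sup>2 - u * b\<^sup>2 = 1 + 2 * (2 * d + 2 * d\<^sup>2 - 2 * u * c\<^sup>2)"
      by (simp add: power2_eq_square algebra_simps)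
    thus ?thesis using two[OF assms] odd_two_adic_intI by metis
  next
    case oo
    then obtain c d where "a = 1 + 2 * c" "b = 1 + 2 * d" by (metis odd_two_adic_intE)
    hence "a\<^sup>2 - u * b\<^sup>2 = 2 + 4 * (c + c\<^sup>2 - 1 - v - u * (d + d\<^sup>2))"
      by (simp add: v power2_eq_square algebra_simps)
    hence "4 dvd 2 + 4 * (c + c\<^sup>2 - 1 - v - u * (d + d\<^sup>2))" using assms by simp
    hence "4 dvd (2 :: two_adic_int)" by (metis dvd_add_left_iff dvd_triv_left)
    hence "2 ^ 2 dvd (2 ^ 1 :: two_adic_int)" by simp
    thus ?thesis unfolding pow2_dvd_iff residue_pow2 by simp
  qed auto
qed

text \<open>Descent from \<open>norm_form_divisible_by_4\<close>, halving both coordinates at each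
  step. It turns the valuation of the norm into divisibility in \<open>OK\<close>, which is why
  \<open>OK\<close> is the full unit ball.\<close>

lemma norm_form_divisible: "4 ^ n dvd a\<^sup>2 - u * b\<^sup>2 \<longleftrightarrow> 2 ^ n dvd a \<and> 2 ^ n dvd b"
proof (induction n arbitrary: a b)
  case (Suc n)
  show ?case
  proof
    assume *: "4 ^ Suc n dvd a\<^sup>2 - u * b\<^sup>2"
    hence "4 dvd a\<^sup>2 - u * b\<^sup>2" by (metis dvd_mult_left power_Suc)
    then obtain c d where cd: "a = 2 * c" "b = 2 * d" using norm_form_divisible_by_4 by blast
    have "a\<^sup>2 - u * b\<^sup>2 = 4 * (c\<^sup>2 - u * d\<^sup>2)" by (simp add: cd power2_eq_square algebra_simps)
    moreover have "(4 :: two_adic_int) \<noteq> 0" using of_nat_two_adic_eq_0_iff[of 4] by simp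
    ultimately have "4 ^ n dvd c\<^sup>2 - u * d\<^sup>2"
      using * by (simp only: power_Suc dvd_mult_cancel_left) simp
    with Suc have "2 ^ n dvd c \<and> 2 ^ n dvd d" by blast
    thus "2 ^ Suc n dvd a \<and> 2 ^ Suc n dvd b" by (auto simp: cd intro: mult_dvd_mono)
  next
    assume "2 ^ Suc n dvd a \<and> 2 ^ Suc n dvd b"
    then obtain c d where "a = 2 ^ Suc n * c" "b = 2 ^ Suc n * d" by (auto elim!: dvdE)
    hence "a\<^sup>2 - u * b\<^sup>2 = (2 ^ Suc n)\<^sup>2 * (c\<^sup>2 - u * d\<^sup>2)"
      by (simp add: power_mult_distrib right_diff_distrib mult_ac)
    also have "((2 :: two_adic_int) ^ Suc n)\<^sup>2 = 4 ^ Suc n"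
      by (metis numeral_Bit0 mult_2 power2_eq_square power_mult_distrib one_add_one)
    finally show "4 ^ Suc n dvd a\<^sup>2 - u * b\<^sup>2" by simp
  qed
qed simp

text \<open>A zero norm is divisible by every power of 4, hence both coordinates by every power of
  2. This is what makes 1 and \<delta> linearly independent.\<close>

lemma norm_form_eq_0: "a\<^sup>2 - u * b\<^sup>2 = 0 \<longleftrightarrow> a = 0 \<and> b = 0"
proof
  assume "a\<^sup>2 - u * b\<^sup>2 = 0"
  hence "2 ^ n dvd a \<and> 2 ^ n dvd b" for n using norm_form_divisible[of n a b] by simp
  thus "a = 0 \<and> b = 0" using pow2_dvd_all_imp_0 by blast
qed simp

lemma elt_eq_0_iff: "elt a b = 0 \<longleftrightarrow> a = 0 \<and> b = 0"
proof
  assume "elt a b = 0"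
  hence "of_two_adic_int (a\<^sup>2 - u * b\<^sup>2) = 0" unfolding elt_conj_mult[symmetric] by simp
  thus "a = 0 \<and> b = 0" by (simp only: of_two_adic_int_eq_0_iff norm_form_eq_0)
qed (simp add: elt_def)

lemma elt_eq_iff: "elt a b = elt c d \<longleftrightarrow> a = c \<and> b = d"
  using elt_eq_0_iff[of "a - c" "b - d"] by (auto simp flip: elt_diff)

lemma pow2_mult_elt: "2 ^ n * elt a b = elt (2 ^ n * a) (2 ^ n * b)"
  by (simp add: elt_def algebra_simps)

lemma pdvd_elt_iff: "pdvd n (elt a b) \<longleftrightarrow> 2 ^ n dvd a \<and> 2 ^ n dvd b"
proof
  assume "pdvd n (elt a b)"
  then obtain c d where "elt a b = 2 ^ n * elt c d" by (auto simp: pdvd_def OK_def)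
  thus "2 ^ n dvd a \<and> 2 ^ n dvd b" by (simp add: pow2_mult_elt elt_eq_iff)
next
  assume "2 ^ n dvd a \<and> 2 ^ n dvd b"
  then obtain c d where "elt a b = 2 ^ n * elt c d" by (auto simp: pow2_mult_elt elim!: dvdE)
  thus "pdvd n (elt a b)" by (auto simp: pdvd_def)
qed

lemma pdvd_of_two_adic_int_iff: "pdvd n (of_two_adic_int a) \<longleftrightarrow> 2 ^ n dvd a"
  by (simp add: of_two_adic_int_eq_elt pdvd_elt_iff)

lemma pdvd_all_imp_0:
  assumes "\<And>n. pdvd n z"
  shows "z = 0"
proof -
  obtain a b where z: "z = elt a b" using pdvd_imp_OK[OF assms] by (auto simp: OK_def)
  thus ?thesis using assms pow2_dvd_all_imp_0 by (simp add: pdvd_elt_iff elt_eq_0_iff)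
qed

text \<open>An element of odd norm is a unit of \<open>OK\<close>: its inverse is the conjugate
  times the inverse of the norm.\<close>

lemma pdvd_mult_elt_odd_norm:
  assumes "\<not> 2 dvd a\<^sup>2 - u * b\<^sup>2"
  shows "pdvd n (z * elt a b) \<longleftrightarrow> pdvd n z"
proof
  assume *: "pdvd n (z * elt a b)"
  obtain v where v: "(a\<^sup>2 - u * b\<^sup>2) * v = 1" using odd_two_adic_int_unit[OF assms] .
  have "elt a b * elt a (- b) * of_two_adic_int v = of_two_adic_int ((a\<^sup>2 - u * b\<^sup>2) * v)"
    by (simp only: elt_conj_mult of_two_adic_int_simps)
  hence "z = z * elt a b * (elt a (- b) * of_two_adic_int v)" by (simp add: v mult.assoc)
  thus "pdvd n z" using * pdvd_mult_OK by (metis OK_mult elt_in_OK of_in_OK)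
qed (auto intro: pdvd_mult_OK)

text \<open>The field generated by \<delta>. Powers of 2 suffice as denominators because every
  nonzero norm is a power of 2 times a unit.\<close>

definition F :: "two_adic alg_closure set" where
  "F = {elt a b / 2 ^ n | a b n. True}"

lemma elt_divide_in_F [simp, intro]: "elt a b / 2 ^ n \<in> F" by (auto simp: F_def)

lemma F_add:
  assumes "x \<in> F" "y \<in> F"
  shows "x + y \<in> F"
proof -
  obtain a b m c d n where "x = elt a b / 2 ^ m" "y = elt c d / 2 ^ n"
    using assms by (auto simp: F_def)
  hence "x + y = (2 ^ n * elt a b + 2 ^ m * elt c d) / 2 ^ (m + n)"
    by (simp add: add_frac_eq power_add mult_ac)
  thus ?thesis by (auto simp: pow2_mult_elt elt_add)
qed

lemma F_is_subfield: "is_subfield F"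
  unfolding is_subfield_def
proof (intro conjI ballI)
  show "0 \<in> F" "1 \<in> F" using elt_divide_in_F[of 0 0 0] elt_divide_in_F[of 1 0 0]
    by (simp_all add: elt_def)
  fix x assume "x \<in> F"
  then obtain a b n where x: "x = elt a b / 2 ^ n" by (auto simp: F_def)
  show "- x \<in> F" unfolding x minus_divide_left elt_minus ..
  show "x + y \<in> F" if "y \<in> F" for y using \<open>x \<in> F\<close> that by (rule F_add)
  show "x * y \<in> F" if y: "y \<in> F" for y
  proof -
    from y obtain c d m where y: "y = elt c d / 2 ^ m" by (auto simp: F_def)
    have "x * y = elt a b * elt c d / 2 ^ (n + m)" by (simp add: x y power_add)
    thus ?thesis by (simp add: elt_mult)
  qed
  show "inverse x \<in> F"
  proof (cases "x = 0")
    case False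
    hence "a\<^sup>2 - u * b\<^sup>2 \<noteq> 0" unfolding norm_form_eq_0 by (auto simp: x elt_eq_0_iff)
    then obtain m v where v: "a\<^sup>2 - u * b\<^sup>2 = 2 ^ m * v" "\<not> 2 dvd v"
      using two_adic_decomp by blast
    obtain w where w: "v * w = 1" using odd_two_adic_int_unit[OF v(2)] .
    have "x * (2 ^ n * elt a (- b) * elt w 0 / 2 ^ m)
        = (elt a b * elt a (- b)) * of_two_adic_int w / 2 ^ m"
      by (simp add: x of_two_adic_int_eq_elt)
    also have "\<dots> = of_two_adic_int (v * w)" unfolding elt_conj_mult v by simp
    finally have "x * (2 ^ n * elt a (- b) * elt w 0 / 2 ^ m) = 1" by (simp add: w)
    hence "inverse x = 2 ^ n * elt a (- b) * elt w 0 / 2 ^ m" by (rule inverse_unique)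
    thus ?thesis by (simp add: pow2_mult_elt elt_mult)
  qed (use \<open>0 \<in> F\<close> in simp)
qed

lemma OK_subset_F: "OK \<subseteq> F"
proof
  fix z assume "z \<in> OK"
  thus "z \<in> F" using elt_divide_in_F[of _ _ 0] by (auto simp: OK_def)
qed

lemma range_to_ac_subset_F: "range to_ac \<subseteq> F"
proof
  fix z :: "two_adic alg_closure" assume "z \<in> range to_ac"
  then obtain a n where "z = of_two_adic_int a / 2 ^ n" by (metis rangeE to_ac_eq_divide_pow2)
  thus "z \<in> F" by (simp add: of_two_adic_int_eq_elt)
qed

end

section \<open>Absolute value and logarithm\<close>

lemma two_adic_int_abs_pow2: "two_adic_int_abs (2 ^ n) = (1 / 2) ^ n"
  using nu2_decomp[OF not_two_dvd_1, of n] two_adic_2_neq_0 by (simp add: two_adic_int_abs_def)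

lemma two_adic_int_abs_nonneg [simp]: "two_adic_int_abs x \<ge> 0"
  by (simp add: two_adic_int_abs_def)

lemma two_adic_int_abs_le_iff: "two_adic_int_abs x \<le> (1 / 2) ^ k \<longleftrightarrow> 2 ^ k dvd x"
proof (cases "x = 0")
  case False
  then obtain n v where v: "x = 2 ^ n * v" "\<not> 2 dvd v" using two_adic_decomp by blast
  have "two_adic_int_abs x \<le> (1 / 2) ^ k \<longleftrightarrow> k \<le> n"
    using False v two_adic_2_neq_0 by (simp add: two_adic_int_abs_def nu2_decomp power_decreasing_iff)
  also have "\<dots> \<longleftrightarrow> 2 ^ k dvd x" by (simp add: v pow2_dvd_pow2_mult_odd_iff)
  finally show ?thesis .
qed (simp add: two_adic_int_abs_def)

lemma to_ac_Fract_pow2: "to_ac (Fract a (2 ^ n)) = of_two_adic_int a / 2 ^ n"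
proof -
  have "Fract a (2 ^ n) = Fract a 1 / Fract (2 ^ n) 1"
    using two_adic_2_neq_0 by simp
  hence "to_ac (Fract a (2 ^ n)) = of_two_adic_int a / of_two_adic_int (2 ^ n)"
    by (simp only: of_two_adic_int_def to_ac_divide)
  thus ?thesis by simp
qed

lemma min_poly_to_ac: "min_poly (to_ac c) = [:- c, 1:]"
proof (rule min_poly_eqI)
  show "Factorial_Ring.irreducible [:- c, 1:]"
    by (rule irreducible_linear_field_poly) simp
qed (simp_all add: map_poly_pCons)

text \<open>Induction on \<open>k\<close> by Pascal's rule: \<open>2 ^ n choose Suc k\<close> is
  divisible by \<open>2 ^ n\<close> up to the power of 2 contained in \<open>Suc k\<close>, and the
  factor \<open>2 ^ Suc k\<close> makes up for that loss.\<close>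

lemma pow2_dvd_pow2_mult_binomial_diff:
  "(2 :: int) ^ n dvd 2 ^ k * (of_nat (2 ^ n - 1 choose k) - (- 1) ^ k)"
proof (induction k)
  case (Suc k)
  define c where "c j = (of_nat (2 ^ n - 1 choose j) :: int)" for j
  have "Suc (2 ^ n - 1) = (2 :: nat) ^ n" by simp
  hence sum: "int (2 ^ n choose Suc k) = c k + c (Suc k)"
    by (metis binomial_Suc_Suc c_def of_nat_add)
  have abs: "Suc k * (2 ^ n choose Suc k) = 2 ^ n * (2 ^ n - 1 choose k)"
    using times_binomial_minus1_eq[of "Suc k" "2 ^ n"] by simp
  obtain a m where am: "Suc k = 2 ^ a * m" "odd m"
    using multiplicity_decompose'[of "Suc k" 2]
    by (metis mult.commute nat.distinct(1) not_is_unit_0 odd_one)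
  have "2 ^ n dvd m * (2 ^ a * (2 ^ n choose Suc k))"
    using abs unfolding am(1) by (metis dvd_triv_left mult.assoc mult.commute)
  moreover have "coprime (2 ^ n) m" using am(2) by simp
  ultimately have "2 ^ n dvd 2 ^ a * (2 ^ n choose Suc k)"
    by (simp add: coprime_dvd_mult_right_iff)
  moreover have "a \<le> Suc k"
  proof -
    have "a < 2 ^ a" by (rule less_exp)
    also have "\<dots> \<le> 2 ^ a * m" using am(2) by (cases m) auto
    finally show ?thesis using am(1) by simp
  qed
  ultimately have "2 ^ n dvd 2 ^ Suc k * (2 ^ n choose Suc k)"
    by (meson dvd_trans le_imp_power_dvd mult_dvd_mono dvd_refl)
  hence "int (2 ^ n) dvd int (2 ^ Suc k * (2 ^ n choose Suc k))" by (simp only: of_nat_dvd_iff)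
  hence "2 ^ n dvd 2 ^ Suc k * (c k + c (Suc k))" by (simp only: of_nat_mult of_nat_power sum of_nat_numeral)
  moreover have "2 ^ n dvd 2 * (2 ^ k * (c k - (- 1) ^ k))"
    using Suc by (simp add: c_def)
  ultimately have "2 ^ n dvd 2 ^ Suc k * (c k + c (Suc k)) - 2 * (2 ^ k * (c k - (- 1) ^ k))"
    by (rule dvd_diff)
  also have "\<dots> = 2 ^ Suc k * (c (Suc k) - (- 1) ^ Suc k)" by (simp add: algebra_simps)
  finally show ?case by (simp add: c_def)
qed simp

context quadratic_extension
begin

text \<open>For nonzero \<open>b\<close> the minimal polynomial has degree 2 and the norm as
  constant coefficient. For \<open>b = 0\<close> it is linear, but the square root of the squared
  value gives the same formula.\<close>

lemma ac_abs_elt_divide: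
  "ac_abs (elt a b / 2 ^ n) = sqrt (two_adic_int_abs (a\<^sup>2 - u * b\<^sup>2)) * 2 ^ n"
proof (cases "b = 0")
  case True
  have "elt a b / 2 ^ n = to_ac (Fract a (2 ^ n))"
    by (simp add: True to_ac_Fract_pow2 of_two_adic_int_eq_elt)
  hence "ac_abs (elt a b / 2 ^ n) = two_adic_abs (Fract (- a) (2 ^ n))"
    by (simp add: ac_abs_def min_poly_to_ac)
  also have "\<dots> = two_adic_int_abs (- a) * 2 ^ n"
    using two_adic_2_neq_0 by (simp add: two_adic_abs_Fract two_adic_int_abs_pow2 power_one_over)
  also have "two_adic_int_abs (- a) = sqrt (two_adic_int_abs (- a * - a))"
    unfolding two_adic_int_abs_mult by simp
  finally show ?thesis by (simp add: True power2_eq_square)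
next
  case False
  define z where "z = elt a b / 2 ^ n"
  \<comment> \<open>\<open>c\<close> is the norm of \<open>z\<close>, and \<open>p\<close> is X^2
    minus the trace times X plus the norm.\<close>
  define c where "c = Fract (a\<^sup>2 - u * b\<^sup>2) (2 ^ (2 * n))"
  define p where "p = [:c, Fract (- 2 * a) (2 ^ n), 1:]"
  have root: "poly (map_poly to_ac p) z = 0"
  proof -
    have "elt a (- b) = 2 * of_two_adic_int a - elt a b" by (simp add: elt_def)
    with elt_conj_mult[of a b]
    have "of_two_adic_int (a\<^sup>2 - u * b\<^sup>2) = elt a b * (2 * of_two_adic_int a - elt a b)" by simp
    hence "to_ac c = elt a b * (2 * of_two_adic_int a - elt a b) / 2 ^ (2 * n)"
      by (simp only: c_def to_ac_Fract_pow2)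
    moreover have "to_ac (Fract (- 2 * a) (2 ^ n)) = - 2 * of_two_adic_int a / 2 ^ n"
      unfolding to_ac_Fract_pow2 by simp
    ultimately show ?thesis
      by (simp add: p_def z_def map_poly_pCons power_mult power2_eq_square field_simps)
  qed
  have "z \<notin> range to_ac"
  proof
    assume "z \<in> range to_ac"
    then obtain d m where "z = of_two_adic_int d / 2 ^ m" by (metis rangeE to_ac_eq_divide_pow2)
    hence "2 ^ m * elt a b = 2 ^ n * elt d 0"
      by (simp add: z_def of_two_adic_int_eq_elt field_simps)
    hence "2 ^ m * b = 0" by (simp add: pow2_mult_elt elt_eq_iff)
    thus False using False two_adic_2_neq_0 by simp
  qed
  hence "min_poly z = p"
    using root by (intro min_poly_eqI degree_2_irreducibleI) (simp_all add: p_def)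
  hence "ac_abs z = sqrt (two_adic_abs c)"
    by (simp add: ac_abs_def p_def sqrt_def numeral_2_eq_2)
  also have "two_adic_abs c = two_adic_int_abs (a\<^sup>2 - u * b\<^sup>2) * (2 ^ n)\<^sup>2"
    using two_adic_2_neq_0
    by (simp only: c_def two_adic_abs_Fract two_adic_int_abs_pow2 power_not_zero not_False_eq_True)
      (simp add: power_one_over power_mult power2_eq_square power_mult_distrib[symmetric])
  finally show ?thesis by (simp add: z_def real_sqrt_mult)
qed

lemma ac_abs_nonneg: "z \<in> F \<Longrightarrow> ac_abs z \<ge> 0"
  by (auto simp: F_def ac_abs_elt_divide)

text \<open>By \<open>norm_form_divisible\<close>, a power \<open>4 ^ k\<close> divides the norm
  exactly when \<open>2 ^ k\<close> divides both coordinates. Convergence can thereby be tested with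
  \<open>pdvd\<close>.\<close>

lemma ac_abs_le_iff:
  assumes "z \<in> F"
  shows "ac_abs z \<le> (1 / 2) ^ m \<longleftrightarrow> pdvd m z"
proof -
  obtain a b n where z: "z = elt a b / 2 ^ n" using assms by (auto simp: F_def)
  let ?N = "a\<^sup>2 - u * b\<^sup>2"
  have "ac_abs z \<le> (1 / 2) ^ m \<longleftrightarrow> sqrt (two_adic_int_abs ?N) \<le> (1 / 2) ^ (n + m)"
    by (simp add: z ac_abs_elt_divide power_add field_simps)
  also have "\<dots> \<longleftrightarrow> sqrt (two_adic_int_abs ?N) \<le> sqrt (((1 / 2) ^ (n + m))\<^sup>2)" by simp
  also have "\<dots> \<longleftrightarrow> two_adic_int_abs ?N \<le> (1 / 2) ^ (2 * (n + m))"
    by (simp only: real_sqrt_le_iff power_even_eq)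
  also have "\<dots> \<longleftrightarrow> 4 ^ (n + m) dvd ?N"
    by (subst two_adic_int_abs_le_iff) (simp only: power_mult, simp)
  also have "\<dots> \<longleftrightarrow> pdvd (n + m) (elt a b)" by (simp add: norm_form_divisible pdvd_elt_iff)
  also have "elt a b = 2 ^ n * z" by (simp add: z)
  finally show ?thesis by (simp only: pdvd_pow2_mult)
qed

lemma F_diff: "x \<in> F \<Longrightarrow> y \<in> F \<Longrightarrow> x - y \<in> F"
  using F_is_subfield unfolding is_subfield_def by (metis diff_conv_add_uminus)

lemma OK_in_F [simp]: "x \<in> OK \<Longrightarrow> x \<in> F" using OK_subset_F by blast

text \<open>The partial sums approach \<open>l\<close> at rate \<open>(1 / 2) ^ n\<close>, and any
  other limit in \<open>F\<close> differs from \<open>l\<close> by an element divisible by all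
  powers of 2. This resolves the description operator in the definition.\<close>

lemma log2_adic_eqI:
  fixes x l :: "two_adic alg_closure"
  defines "S \<equiv> \<lambda>n. \<Sum>k=1..n. (- 1) ^ (k + 1) * (x - 1) ^ k / of_nat k"
  assumes S: "\<And>n. S n \<in> OK" and l: "\<And>n. pdvd n (l - S n)"
  shows "log2_adic F x = l"
proof -
  have S_eq: "(\<Sum>k=1..n. (- 1) ^ (k + 1) * (x - 1) ^ k / of_nat k) = S n" for n
    by (simp add: S_def)
  show ?thesis
    unfolding log2_adic_def S_eq
  proof (rule the_equality)
    have "l = (l - S 0) + S 0" by simp
    also have "\<dots> \<in> OK" by (rule OK_add[OF pdvd_imp_OK[OF l] S])
    finally have "l \<in> OK" .
    moreover have "(\<lambda>n. ac_abs (l - S n)) \<longlonglongrightarrow> 0"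
    proof (rule tendsto_sandwich[where f = "\<lambda>_. 0" and h = "\<lambda>n. (1 / 2) ^ n"])
      show "(\<lambda>n. (1 / 2 :: real) ^ n) \<longlonglongrightarrow> 0" by (rule LIMSEQ_power_zero) simp
      have F: "l - S n \<in> F" for n by (rule OK_in_F[OF pdvd_imp_OK[OF l]])
      show "\<forall>\<^sub>F n in sequentially. 0 \<le> ac_abs (l - S n)" using ac_abs_nonneg[OF F] by simp
      show "\<forall>\<^sub>F n in sequentially. ac_abs (l - S n) \<le> (1 / 2) ^ n" using ac_abs_le_iff[OF F] l by simp
    qed simp
    ultimately show "l \<in> F \<and> (\<lambda>n. ac_abs (l - S n)) \<longlonglongrightarrow> 0" by simp
    fix y assume y: "y \<in> F \<and> (\<lambda>n. ac_abs (y - S n)) \<longlonglongrightarrow> 0"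
    have "pdvd m (y - l)" for m
    proof -
      have "\<forall>\<^sub>F n in sequentially. ac_abs (y - S n) < (1 / 2) ^ m"
        using y by (intro order_tendstoD) auto
      then obtain n where n: "n \<ge> m" "ac_abs (y - S n) < (1 / 2) ^ m"
        by (meson eventually_at_top_linorder max.cobounded1 max.cobounded2)
      hence "pdvd m (y - S n)"
        using ac_abs_le_iff[of "y - S n" m] y S by (simp add: F_diff)
      moreover have "pdvd m (l - S n)" using l n(1) by (rule pdvd_mono)
      ultimately have "pdvd m ((y - S n) - (l - S n))" by (rule pdvd_diff)
      thus ?thesis by simp
    qed
    hence "y - l = 0" by (rule pdvd_all_imp_0)
    thus "y = l" by simp
  qed
qed

lemma OK_complete:
  assumes "\<And>n. s n \<in> OK" "\<And>n. pdvd n (s (Suc n) - s n)"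
  obtains l where "l \<in> OK" "\<And>n. pdvd n (l - s n)"
proof -
  have "\<forall>n. \<exists>a b. s n = elt a b" using assms(1) by (auto simp: OK_def)
  then obtain a b where s: "\<And>n. s n = elt (a n) (b n)" by metis
  have "2 ^ n dvd a (Suc n) - a n" "2 ^ n dvd b (Suc n) - b n" for n
    using assms(2)[of n] by (simp_all add: s elt_diff pdvd_elt_iff)
  then obtain la lb where "\<And>n. 2 ^ n dvd la - a n" "\<And>n. 2 ^ n dvd lb - b n"
    by (metis two_adic_int_complete)
  hence "pdvd n (elt la lb - s n)" for n by (simp add: s elt_diff pdvd_elt_iff)
  thus ?thesis by (rule that[rotated]) simp
qed

text \<open>Modulo \<open>2 ^ n\<close>, the number \<open>l\<close> is \<open>(z ^ 2 ^ n - 1) / 2 ^ n\<close>; hence \<open>l\<close> is the limit of these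
  quotients, a description of the logarithm that makes it visibly additive.\<close>

definition is_log :: "two_adic alg_closure \<Rightarrow> two_adic alg_closure \<Rightarrow> bool" where
  "is_log z l \<longleftrightarrow> pdvd 2 (z - 1) \<and> l \<in> OK \<and> (\<forall>n. pdvd (2 * n) (z ^ 2 ^ n - 1 - 2 ^ n * l))"

text \<open>Expanding \<open>(1 + 4 * t) ^ 2 ^ n\<close> by the binomial theorem, the coefficients
  \<open>(2 ^ n choose k) / 2 ^ n\<close> tend to \<open>(- 1) ^ (k + 1) / k\<close>; the loss of precision in \<open>k\<close> is paid for
  by the factor \<open>4 ^ k\<close>.\<close>

lemma is_log_log2_adic_aux:
  assumes "t \<in> OK"
  shows "is_log (1 + 4 * t) (log2_adic F (1 + 4 * t))"
proof -
  define S where "S n = (\<Sum>k=1..n. (- 1) ^ (k + 1) * (1 + 4 * t - 1) ^ k / of_nat k)" for n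
  \<comment> \<open>\<open>m k\<close> stands for \<open>2 ^ k / k\<close>: of the two factors
    \<open>2 ^ k\<close> in \<open>4 ^ k\<close>, one cancels the denominator and the other gives
    convergence.\<close>
  have "\<forall>k. \<exists>m. k > 0 \<longrightarrow> (2 :: two_adic_int) ^ k = of_nat k * m"
    using of_nat_dvd_pow2 by (metis dvdE)
  then obtain m where m: "\<And>k. k > 0 \<Longrightarrow> (2 :: two_adic_int) ^ k = of_nat k * m k" by metis
  have expand: "(4 * t) ^ k = of_nat k * (2 ^ k * (of_two_adic_int (m k) * t ^ k))" if "k > 0" for k
  proof -
    have p: "(2 :: two_adic alg_closure) ^ k = of_nat k * of_two_adic_int (m k)"
      using arg_cong[OF m[OF that], of of_two_adic_int] by simp
    have "(4 * t) ^ k = (2 * (2 * t)) ^ k" by simp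
    also have "\<dots> = 2 ^ k * (2 ^ k * t ^ k)" by (simp only: power_mult_distrib)
    also have "2 ^ k * (2 ^ k * t ^ k) = of_nat k * (2 ^ k * (of_two_adic_int (m k) * t ^ k))"
      by (simp only: p mult_ac)
    finally show ?thesis .
  qed
  have S_eq: "S n = (\<Sum>k=1..n. (- 1) ^ (k + 1) * (2 ^ k * (of_two_adic_int (m k) * t ^ k)))" for n
    unfolding S_def add_diff_cancel_left'
  proof (intro sum.cong refl)
    fix k assume k: "k \<in> {1..n}"
    show "(- 1) ^ (k + 1) * (4 * t) ^ k / of_nat k = (- 1) ^ (k + 1) * (2 ^ k * (of_two_adic_int (m k) * t ^ k))"
      using k by (subst expand) simp_all
  qed
  have summand: "pdvd k (c * (2 ^ k * (of_two_adic_int (m k) * t ^ k)))" if "c \<in> OK" for c k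
    unfolding mult.left_commute[of c] using assms that by (auto simp: pdvd_def)
  have S_in: "S n \<in> OK" for n
    unfolding S_eq using assms by (intro OK_sum OK_mult OK_power OK_minus OK_1 of_in_OK OK_numeral)
  have S_step: "pdvd n (S (Suc n) - S n)" for n
  proof -
    have "S (Suc n) - S n = (- 1) ^ (Suc n + 1) * (2 ^ Suc n * (of_two_adic_int (m (Suc n)) * t ^ Suc n))"
      by (simp add: S_eq)
    also have "pdvd (Suc n) \<dots>" by (rule summand) auto
    finally show ?thesis by (rule pdvd_mono) simp
  qed
  obtain l where l: "l \<in> OK" "\<And>n. pdvd n (l - S n)" using OK_complete[OF S_in S_step] by blast
  have log: "log2_adic F (1 + 4 * t) = l"
    by (rule log2_adic_eqI) (use S_in l(2) in \<open>simp_all only: S_def\<close>)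
  have "pdvd (2 * n) ((1 + 4 * t) ^ 2 ^ n - 1 - 2 ^ n * l)" for n
  proof -
    let ?N = "2 ^ n :: nat"
    \<comment> \<open>\<open>c k\<close> is the error made when the \<open>k\<close>-th binomial
      term, divided by \<open>2 ^ n\<close>, is replaced by the \<open>k\<close>-th term of the
      series. Absorbing \<open>1 / k\<close> turns \<open>2 ^ n choose k\<close> into
      \<open>2 ^ n - 1 choose (k - 1)\<close>, which is close to
      \<open>(- 1) ^ (k - 1)\<close>.\<close>
    define c where "c k = of_int (of_nat (?N - 1 choose (k - 1)) - (- 1) ^ (k - 1)) 
        * (2 ^ k * (of_two_adic_int (m k) * t ^ k))" for k
    have "(1 + 4 * t) ^ ?N - 1 = (\<Sum>k=0..?N. of_nat (?N choose k) * (4 * t) ^ k) - 1"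
      using binomial_ring[of "4 * t" 1 ?N] by (simp add: add.commute atLeast0AtMost)
    also have "\<dots> = (\<Sum>k=1..?N. of_nat (?N choose k) * (4 * t) ^ k)"
      by (subst sum.atLeast_Suc_atMost) auto
    also have "\<dots> = (\<Sum>k=1..?N. 2 ^ n * (c k + (- 1) ^ (k + 1) * (2 ^ k * (of_two_adic_int (m k) * t ^ k))))"
    proof (intro sum.cong refl)
      fix k assume k: "k \<in> {1..?N}"
      have "k * (?N choose k) = ?N * (?N - 1 choose (k - 1))"
        using k by (intro times_binomial_minus1_eq) simp
      hence "(of_nat k * of_nat (?N choose k) :: two_adic alg_closure) = of_nat ?N * of_nat (?N - 1 choose (k - 1))"
        by (metis of_nat_mult)
      hence "of_nat (?N choose k) * (4 * t) ^ k
          = 2 ^ n * (of_nat (?N - 1 choose (k - 1)) * (2 ^ k * (of_two_adic_int (m k) * t ^ k)))"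
        using k by (subst expand) (simp_all add: mult_ac)
      also have "(- 1 :: two_adic alg_closure) ^ (k + 1) = (- 1) ^ (k - 1)"
        using k by (cases k) auto
      hence "of_nat (?N - 1 choose (k - 1)) * (2 ^ k * (of_two_adic_int (m k) * t ^ k))
          = c k + (- 1) ^ (k + 1) * (2 ^ k * (of_two_adic_int (m k) * t ^ k))"
        by (simp add: c_def left_diff_distrib)
      finally show "of_nat (?N choose k) * (4 * t) ^ k
          = 2 ^ n * (c k + (- 1) ^ (k + 1) * (2 ^ k * (of_two_adic_int (m k) * t ^ k)))" .
    qed
    also have "\<dots> = 2 ^ n * (\<Sum>k=1..?N. c k) + 2 ^ n * S ?N"
      by (simp only: S_eq sum.distrib distrib_left sum_distrib_left)
    finally have eq: "(1 + 4 * t) ^ ?N - 1 - 2 ^ n * l = 2 ^ n * ((\<Sum>k=1..?N. c k) - (l - S ?N))"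
      by (simp add: algebra_simps)
    \<comment> \<open>The factor \<open>2 ^ k\<close> kept in \<open>c k\<close> covers the
      \<open>2 ^ (k - 1)\<close> demanded by
      \<open>pow2_dvd_pow2_mult_binomial_diff\<close>.\<close>
    have "pdvd n (c k)" if "k \<in> {1..?N}" for k
    proof -
      let ?d = "of_nat (?N - 1 choose (k - 1)) - (- 1) ^ (k - 1) :: int"
      have "2 ^ n dvd 2 ^ (k - 1) * ?d" by (rule pow2_dvd_pow2_mult_binomial_diff)
      hence "2 ^ n dvd 2 * (2 ^ (k - 1) * ?d)" by (rule dvd_mult)
      also have "2 * (2 ^ (k - 1) * ?d) = 2 ^ k * ?d" using that by (cases k) simp_all
      finally obtain e where e: "2 ^ k * ?d = 2 ^ n * e" by (elim dvdE)
      have "c k = of_int (2 ^ k * ?d) * (of_two_adic_int (m k) * t ^ k)"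
        unfolding c_def by (simp only: of_int_mult of_int_power of_int_numeral mult_ac)
      hence "c k = 2 ^ n * (of_int e * (of_two_adic_int (m k) * t ^ k))"
        unfolding e by (simp add: mult_ac)
      thus ?thesis using assms by (auto simp: pdvd_def)
    qed
    moreover have "pdvd n (l - S ?N)" using l(2)[of ?N] by (rule pdvd_mono) (simp add: less_imp_le)
    ultimately have "pdvd n ((\<Sum>k=1..?N. c k) - (l - S ?N))" by (rule pdvd_diff[OF pdvd_sum])
    thus ?thesis unfolding eq mult_2 pdvd_pow2_mult .
  qed
  moreover have "pdvd 2 (1 + 4 * t - 1)" using assms by (auto simp: pdvd_def)
  ultimately show ?thesis using l(1) by (simp add: is_log_def log)
qed

lemma is_log_log2_adic: "pdvd 2 (z - 1) \<Longrightarrow> is_log z (log2_adic F z)"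
  using is_log_log2_adic_aux by (force simp: pdvd_def algebra_simps)

lemma pdvd_mult_minus_1:
  assumes "pdvd m (x - 1)" "pdvd m (y - 1)"
  shows "pdvd m (x * y - 1)"
proof -
  have "x * y - 1 = (x - 1) * (y - 1) + ((x - 1) + (y - 1))" by (simp add: algebra_simps)
  also have "pdvd m \<dots>" using assms by (intro pdvd_add pdvd_mult_OK) (auto dest: pdvd_imp_OK)
  finally show ?thesis .
qed

lemma pdvd_power_minus_1: "pdvd m (x - 1) \<Longrightarrow> pdvd m (x ^ k - 1)"
  by (induction k) (simp_all add: pdvd_mult_minus_1)

lemma is_log_1: "is_log 1 0" by (simp add: is_log_def)

text \<open>\<open>x * y - 1\<close> is \<open>(x - 1) * (y - 1)\<close> plus
  \<open>(x - 1) + (y - 1)\<close>. For the \<open>2 ^ n\<close>-th powers both factors of the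
  product are divisible by \<open>2 ^ n\<close>, so the product is negligible at the precision
  \<open>2 * n\<close> of \<open>is_log\<close>.\<close>

lemma is_log_mult:
  assumes "is_log x l" "is_log y m"
  shows "is_log (x * y) (l + m)"
proof -
  have "pdvd (2 * n) ((x * y) ^ 2 ^ n - 1 - 2 ^ n * (l + m))" for n
  proof -
    have rem: "pdvd (n + n) (x ^ 2 ^ n - 1 - 2 ^ n * l)" "pdvd (n + n) (y ^ 2 ^ n - 1 - 2 ^ n * m)"
      using assms by (simp_all add: is_log_def flip: mult_2)
    have "pdvd n (2 ^ n * l)" "pdvd n (2 ^ n * m)" using assms by (auto simp: pdvd_def is_log_def)
    hence "pdvd n ((x ^ 2 ^ n - 1 - 2 ^ n * l) + 2 ^ n * l)"
      "pdvd n ((y ^ 2 ^ n - 1 - 2 ^ n * m) + 2 ^ n * m)"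
      using pdvd_mono[OF rem(1) le_add1] pdvd_mono[OF rem(2) le_add1] by (simp_all only: pdvd_add)
    hence "pdvd (n + n) ((x ^ 2 ^ n - 1) * (y ^ 2 ^ n - 1))"
      by (intro pdvd_mult) simp_all
    hence "pdvd (2 * n) ((x ^ 2 ^ n - 1) * (y ^ 2 ^ n - 1)
        + ((x ^ 2 ^ n - 1 - 2 ^ n * l) + (y ^ 2 ^ n - 1 - 2 ^ n * m)))"
      unfolding mult_2 by (rule pdvd_add[OF _ pdvd_add[OF rem]])
    also have "(x ^ 2 ^ n - 1) * (y ^ 2 ^ n - 1)
        + ((x ^ 2 ^ n - 1 - 2 ^ n * l) + (y ^ 2 ^ n - 1 - 2 ^ n * m))
      = (x * y) ^ 2 ^ n - 1 - 2 ^ n * (l + m)"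
      by (simp add: algebra_simps power_mult_distrib)
    finally show ?thesis .
  qed
  thus ?thesis using assms by (auto simp: is_log_def pdvd_mult_minus_1)
qed

lemma is_log_power: "is_log x l \<Longrightarrow> is_log (x ^ k) (of_nat k * l)"
  by (induction k) (auto simp: is_log_1 distrib_right intro: is_log_mult)

text \<open>Each step factors a difference of squares; \<open>x ^ 2 ^ n + y ^ 2 ^ n\<close> is 2
  times an element of \<open>1 + 2 * OK\<close> because both summands are 1 modulo 4.\<close>

lemma power_pow2_diff:
  assumes "pdvd 2 (x - 1)" "pdvd 2 (y - 1)"
  obtains t where "t \<in> OK" "x ^ 2 ^ n - y ^ 2 ^ n = 2 ^ n * ((x - y) * (1 + 2 * t))"
proof -
  have "\<exists>t\<in>OK. x ^ 2 ^ n - y ^ 2 ^ n = 2 ^ n * ((x - y) * (1 + 2 * t))"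
  proof (induction n)
    case 0
    show ?case by (rule bexI[of _ 0]) simp_all
  next
    case (Suc n)
    then obtain t where t: "t \<in> OK" "x ^ 2 ^ n - y ^ 2 ^ n = 2 ^ n * ((x - y) * (1 + 2 * t))" by blast
    obtain v w where vw: "v \<in> OK" "w \<in> OK" "x ^ 2 ^ n - 1 = 2 ^ 2 * v" "y ^ 2 ^ n - 1 = 2 ^ 2 * w"
      using assms[THEN pdvd_power_minus_1, of "2 ^ n"] by (auto simp only: pdvd_def)
    hence "x ^ 2 ^ n + y ^ 2 ^ n = 2 * (1 + 2 * (v + w))" by (simp add: algebra_simps)
    moreover have "x ^ 2 ^ Suc n - y ^ 2 ^ Suc n = (x ^ 2 ^ n - y ^ 2 ^ n) * (x ^ 2 ^ n + y ^ 2 ^ n)"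
      unfolding power_Suc2 power_mult by (simp add: power2_eq_square algebra_simps)
    ultimately have "x ^ 2 ^ Suc n - y ^ 2 ^ Suc n
        = 2 ^ Suc n * ((x - y) * (1 + 2 * (t + (v + w) + 2 * t * (v + w))))"
      unfolding t(2) by (simp add: algebra_simps)
    moreover have "t + (v + w) + 2 * t * (v + w) \<in> OK" using t(1) vw(1,2) by simp
    ultimately show ?case by blast
  qed
  thus ?thesis using that by blast
qed

text \<open>Subtract the two congruences of \<open>is_log\<close> at level \<open>n\<close> and
  cancel \<open>2 ^ n\<close> by \<open>power_pow2_diff\<close>. The element \<open>t\<close> may
  depend on \<open>n\<close>.\<close>

lemma is_log_diff:
  assumes "is_log x l" "is_log y m"
  obtains t where "t \<in> OK" "pdvd n ((x - y) * (1 + 2 * t) - (l - m))"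
proof -
  obtain t where t: "t \<in> OK" "x ^ 2 ^ n - y ^ 2 ^ n = 2 ^ n * ((x - y) * (1 + 2 * t))"
    using power_pow2_diff assms unfolding is_log_def by blast
  have "pdvd (2 * n) ((x ^ 2 ^ n - 1 - 2 ^ n * l) - (y ^ 2 ^ n - 1 - 2 ^ n * m))"
    using assms unfolding is_log_def by (metis pdvd_diff)
  also have "(x ^ 2 ^ n - 1 - 2 ^ n * l) - (y ^ 2 ^ n - 1 - 2 ^ n * m)
      = (x ^ 2 ^ n - y ^ 2 ^ n) - 2 ^ n * (l - m)" by (simp add: algebra_simps)
  also have "\<dots> = 2 ^ n * ((x - y) * (1 + 2 * t) - (l - m))"
    unfolding t(2) by (simp only: right_diff_distrib)
  finally have "pdvd (n + n) (2 ^ n * ((x - y) * (1 + 2 * t) - (l - m)))" by (simp only: mult_2)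
  thus ?thesis unfolding pdvd_pow2_mult using t(1) by (intro that)
qed

lemma pdvd_mult_one_plus_even:
  assumes "t \<in> OK"
  shows "pdvd n (z * (1 + 2 * t)) \<longleftrightarrow> pdvd n z"
proof -
  obtain a b where "t = elt a b" using assms by (auto simp: OK_def)
  hence "1 + 2 * t = elt (1 + 2 * a) (2 * b)" by (simp add: elt_def algebra_simps)
  moreover have "(1 + 2 * a)\<^sup>2 - u * (2 * b)\<^sup>2 = 1 + 2 * (2 * a + 2 * a\<^sup>2 - 2 * u * b\<^sup>2)"
    by (simp add: power2_eq_square algebra_simps)
  ultimately show ?thesis using odd_two_adic_intI by (metis pdvd_mult_elt_odd_norm)
qed

text \<open>Up to the unit \<open>1 + 2 * t\<close>, the differences \<open>x - y\<close> and
  \<open>l - m\<close> agree modulo \<open>2 ^ n\<close>. This is the isometry property of the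
  logarithm.\<close>

lemma is_log_diff_pdvd_iff:
  assumes "is_log x l" "is_log y m"
  shows "pdvd n (x - y) \<longleftrightarrow> pdvd n (l - m)"
proof -
  obtain t where t: "t \<in> OK" "pdvd n ((x - y) * (1 + 2 * t) - (l - m))"
    using is_log_diff[OF assms] .
  have "pdvd n (x - y) \<longleftrightarrow> pdvd n ((x - y) * (1 + 2 * t))"
    using pdvd_mult_one_plus_even[OF t(1)] by simp
  also have "\<dots> \<longleftrightarrow> pdvd n (l - m)"
    using pdvd_add[OF t(2), of "l - m"] pdvd_diff[of n _ _, OF _ t(2), of "(x - y) * (1 + 2 * t)"]
    by auto
  finally show ?thesis .
qed

text \<open>The isometry replaces \<open>y - x ^ k\<close> by \<open>M - k * L\<close>, a difference
  of logarithms, and the equation for \<zeta> says that 4 times this is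
  \<open>(\<zeta> - (4 * k + 1)) * L\<close>. As \<open>L\<close> is 8 times a unit, one factor 2
  remains, hence \<open>Suc n\<close>.\<close>

lemma pdvd_diff_power_iff:
  fixes \<zeta> :: two_adic_int
  assumes x: "pdvd 2 (x - 1)" and x_eq: "x - 1 = 8 * elt a b" "2 dvd a" "\<not> 2 dvd b"
    and y: "pdvd 2 (y - 1)"
    and zeta: "of_two_adic_int \<zeta> = 1 + 4 / log2_adic F x * log2_adic F y"
  shows "pdvd (Suc n) (y - x ^ k) \<longleftrightarrow> 2 ^ n dvd \<zeta> - of_nat (4 * k + 1)"
proof -
  define L M where "L = log2_adic F x" and "M = log2_adic F y"
  have log: "is_log x L" "is_log y M"
    unfolding L_def M_def using x y by (auto intro: is_log_log2_adic)
  \<comment> \<open>Precision \<open>2 ^ 4\<close> determines \<open>L / 8\<close> modulo 2, so its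
    coordinates keep the parities of \<open>a\<close> and \<open>b\<close> and its norm is
    odd.\<close>
  obtain t where t: "t \<in> OK" "pdvd 4 ((x - 1) * (1 + 2 * t) - (L - 0))"
    using is_log_diff[OF log(1) is_log_1] .
  obtain v where v: "v \<in> OK" "(x - 1) * (1 + 2 * t) - L = 16 * v"
    using t(2) by (auto simp: pdvd_def)
  obtain c d where cd: "elt a b * t - v = elt c d"
    using OK_diff[OF OK_mult[OF elt_in_OK t(1)] v(1), of a b] unfolding OK_def by blast
  have "L = 8 * (elt a b + 2 * (elt a b * t - v))"
    using v(2) unfolding x_eq(1) by (simp add: algebra_simps)
  also have "elt a b + 2 * (elt a b * t - v) = elt (a + 2 * c) (b + 2 * d)"
    unfolding cd by (simp add: elt_def algebra_simps)
  finally have L: "L = 8 * elt (a + 2 * c) (b + 2 * d)" .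
  obtain a' b' v' where "a = 2 * a'" "b = 1 + 2 * b'" "u = 3 + 4 * v'"
    using x_eq(2,3) u_mod_4 by (metis add.commute diff_add_cancel dvdE odd_two_adic_intE)
  hence "(a + 2 * c)\<^sup>2 - u * (b + 2 * d)\<^sup>2
      = 1 + 2 * (2 * (a' + c)\<^sup>2 - 2 - 2 * v' - u * (2 * (b' + d) + 2 * (b' + d)\<^sup>2))"
    by (simp add: power2_eq_square algebra_simps)
  hence odd: "\<not> 2 dvd (a + 2 * c)\<^sup>2 - u * (b + 2 * d)\<^sup>2" using odd_two_adic_intI by metis
  hence "elt (a + 2 * c) (b + 2 * d) \<noteq> 0" unfolding elt_eq_0_iff by (metis norm_form_eq_0 dvd_0_right)
  hence "L \<noteq> 0" unfolding L by simp
  hence "(of_two_adic_int \<zeta> - 1) * L = 4 * M" unfolding zeta L_def M_def by simp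
  hence "4 * (M - of_nat k * L) = of_two_adic_int (\<zeta> - of_nat (4 * k + 1)) * L"
    by (simp add: algebra_simps)
  also have "\<dots> = 2 ^ 3 * (of_two_adic_int (\<zeta> - of_nat (4 * k + 1)) * elt (a + 2 * c) (b + 2 * d))"
    unfolding L by simp
  finally have eq: "2 ^ 2 * (M - of_nat k * L)
      = 2 ^ 3 * (of_two_adic_int (\<zeta> - of_nat (4 * k + 1)) * elt (a + 2 * c) (b + 2 * d))" by simp
  have "pdvd (Suc n) (y - x ^ k) \<longleftrightarrow> pdvd (Suc n) (M - of_nat k * L)"
    by (rule is_log_diff_pdvd_iff[OF log(2) is_log_power[OF log(1)]])
  also have "\<dots> \<longleftrightarrow> pdvd (2 + Suc n) (2 ^ 2 * (M - of_nat k * L))" by (rule pdvd_pow2_mult[symmetric])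
  also have "2 + Suc n = 3 + n" by simp
  also have "pdvd (3 + n) (2 ^ 2 * (M - of_nat k * L)) \<longleftrightarrow> 2 ^ n dvd \<zeta> - of_nat (4 * k + 1)"
    unfolding eq pdvd_pow2_mult pdvd_mult_elt_odd_norm[OF odd] by (rule pdvd_of_two_adic_int_iff)
  finally show ?thesis .
qed

end

section \<open>The roots of the cubic\<close>

text \<open>The parametrisation \<open>\<beta>1 = 2 * (1 + 2 * h)\<close>, \<open>\<beta>2 = s + \<delta>\<close>, \<open>\<beta>3 = s - \<delta>\<close>, with \<open>\<beta>2 * \<beta>3 = 2 * p\<close> as a
  polynomial in \<open>h\<close>, makes all parities visible.\<close>

locale cubic_roots =
  fixes h :: two_adic_int and \<delta> :: "two_adic alg_closure"
  assumes \<delta>_square': "\<delta> ^ 2 = of_two_adic_int (51 + 12 * h - 12 * h\<^sup>2)"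
begin

definition "b = 1 + 2 * h"
definition "s = 5 - 2 * h"
definition "p = 8 * h\<^sup>2 - 16 * h - 13"
definition "u = 51 + 12 * h - 12 * h\<^sup>2"
definition "\<beta>2 = of_two_adic_int s + \<delta>"
definition "\<beta>3 = of_two_adic_int s - \<delta>"

sublocale quadratic_extension \<delta> u
proof
  have "u - 3 = 4 * (12 + 3 * h - 3 * h\<^sup>2)" by (simp add: u_def algebra_simps)
  thus "4 dvd u - 3" by (rule dvdI)
qed (simp add: u_def \<delta>_square' del: of_two_adic_int_simps)

lemma odd_s: "\<not> 2 dvd s"
proof -
  have "s = 1 + 2 * (2 - h)" by (simp add: s_def)
  thus ?thesis using odd_two_adic_intI by metis
qed

lemma odd_p: "\<not> 2 dvd p"
proof -
  have "p = 1 + 2 * (4 * h\<^sup>2 - 8 * h - 7)" by (simp add: p_def)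
  thus ?thesis using odd_two_adic_intI by metis
qed

lemma odd_u: "\<not> 2 dvd u"
proof -
  have "u = 1 + 2 * (25 + 6 * h - 6 * h\<^sup>2)" by (simp add: u_def)
  thus ?thesis using odd_two_adic_intI by metis
qed

lemma u_eq: "u = s\<^sup>2 - 2 * p"
  by (simp add: u_def s_def p_def power2_eq_square algebra_simps)

definition "g = s\<^sup>2 - p"

lemma g_eq: "g = 2 * (1 + 2 * (9 - h - h\<^sup>2))"
  by (simp add: g_def s_def p_def power2_eq_square algebra_simps)

lemma \<beta>2_eq: "\<beta>2 = elt s 1" and \<beta>3_eq: "\<beta>3 = elt s (- 1)"
  by (simp_all add: \<beta>2_def \<beta>3_def elt_def)

lemma \<beta>2_square: "\<beta>2\<^sup>2 = 2 * elt g s"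
proof -
  have "\<beta>2\<^sup>2 = elt (2 * g) (2 * s)"
    unfolding \<beta>2_eq power2_eq_square elt_mult elt_eq_iff
    by (simp add: u_eq g_def power2_eq_square algebra_simps)
  thus ?thesis using pow2_mult_elt[of 1 g s] by simp
qed

text \<open>With \<open>p\<close> odd this makes \<open>elt g s\<close> a unit, so
  \<open>\<beta>2 ^ 2\<close> is 2 times a unit and \<open>\<beta>2 ^ (4 * k)\<close> contributes
  exactly \<open>2 ^ (2 * k)\<close>.\<close>

lemma norm_g_s: "g\<^sup>2 - u * s\<^sup>2 = p\<^sup>2"
  by (simp add: u_eq g_def power2_eq_square algebra_simps)

lemma \<beta>_nonzero: "\<beta>2 \<noteq> 0" "\<beta>3 \<noteq> 0"
  by (simp_all add: \<beta>2_eq \<beta>3_eq elt_eq_0_iff)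

text \<open>\<open>\<beta>3 / \<beta>2\<close> is a unit of norm \<open>1\<close>; its fourth power is close to \<open>1\<close> because its trace is
  divisible by \<open>4\<close>.\<close>

lemma ratio_power_4:
  obtains a c where "(\<beta>3 / \<beta>2) ^ 4 - 1 = 8 * elt a c" "2 dvd a" "\<not> 2 dvd c"
proof -
  obtain \<iota> where \<iota>: "p * \<iota> = 1" using odd_two_adic_int_unit[OF odd_p] .
  \<comment> \<open>The coordinates come from
    \<open>\<beta>3 / \<beta>2 = \<beta>3 ^ 2 / (\<beta>2 * \<beta>3)\<close>, with numerator
    \<open>2 * elt g (- s)\<close> and denominator \<open>2 * p\<close>.\<close>
  have "elt (\<iota> * g) (- \<iota> * s) * \<beta>2 = elt (p * \<iota> * s) (- (p * \<iota>))"
    unfolding \<beta>2_eq elt_mult elt_eq_iff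
    by (simp add: u_eq g_def power2_eq_square algebra_simps)
  hence "elt (\<iota> * g) (- \<iota> * s) * \<beta>2 = \<beta>3" by (simp add: \<iota> \<beta>3_eq)
  hence r: "\<beta>3 / \<beta>2 = elt (\<iota> * g) (- \<iota> * s)" using \<beta>_nonzero by (simp add: field_simps)
  \<comment> \<open>\<open>A\<close> and \<open>- 4 * B\<close> are the coordinates of the squared
    quotient; one factor 2 comes from squaring and the other from \<open>g\<close> being
    even.\<close>
  define A where "A = \<iota>\<^sup>2 * (g\<^sup>2 + u * s\<^sup>2)"
  define B where "B = \<iota>\<^sup>2 * (1 + 2 * (9 - h - h\<^sup>2)) * s"
  have r2: "(\<beta>3 / \<beta>2)\<^sup>2 = elt A (- 4 * B)"
    unfolding r power2_eq_square elt_mult elt_eq_iff A_def B_def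
    by (simp add: g_eq power2_eq_square algebra_simps)
  have square: "((2 * G)\<^sup>2 + u * s\<^sup>2)\<^sup>2 - u * (4 * (G * s))\<^sup>2 = ((2 * G)\<^sup>2 - u * s\<^sup>2)\<^sup>2" for G
    by (simp add: power2_eq_square algebra_simps)
  have "A\<^sup>2 - u * (4 * B)\<^sup>2
      = (\<iota>\<^sup>2)\<^sup>2 * ((g\<^sup>2 + u * s\<^sup>2)\<^sup>2 - u * (4 * ((1 + 2 * (9 - h - h\<^sup>2)) * s))\<^sup>2)"
    unfolding A_def B_def by (simp only: power_mult_distrib right_diff_distrib mult_ac)
  also have "\<dots> = (\<iota>\<^sup>2 * (g\<^sup>2 - u * s\<^sup>2))\<^sup>2"
    unfolding g_eq square by (simp only: power_mult_distrib)
  also have "\<dots> = ((p * \<iota>)\<^sup>2)\<^sup>2" unfolding norm_g_s by (simp add: power_mult_distrib)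
  \<comment> \<open>The squared quotient has norm 1, which expresses \<open>A ^ 2\<close> through
    \<open>B\<close>.\<close>
  finally have A2: "A\<^sup>2 = 1 + 2 * (8 * u * B\<^sup>2)" unfolding \<iota> by (simp add: algebra_simps)
  have "(\<beta>3 / \<beta>2) ^ 4 = (elt A (- 4 * B))\<^sup>2" unfolding r2[symmetric] by (simp flip: power_mult)
  also have "\<dots> = elt (A\<^sup>2 + 16 * u * B\<^sup>2) (- 8 * A * B)"
    unfolding power2_eq_square elt_mult elt_eq_iff by (simp add: algebra_simps)
  also have "\<dots> = 1 + 8 * elt (2 * (2 * u * B\<^sup>2)) (- A * B)"
    unfolding A2 by (simp add: elt_def algebra_simps)
  finally have eq: "(\<beta>3 / \<beta>2) ^ 4 - 1 = 8 * elt (2 * (2 * u * B\<^sup>2)) (- A * B)" by simp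
  have "\<not> 2 dvd A"
  proof
    assume "2 dvd A"
    hence "2 dvd A\<^sup>2" by (simp add: power2_eq_square)
    thus False unfolding A2 using odd_two_adic_intI by blast
  qed
  moreover have "\<not> 2 dvd \<iota>" using \<iota> not_two_dvd_1 by (metis dvd_mult)
  hence "\<not> 2 dvd B"
    unfolding B_def by (intro two_adic_odd_mult two_adic_odd_power odd_two_adic_intI odd_s)
  ultimately have "\<not> 2 dvd - A * B" by (simp add: two_adic_odd_mult)
  show ?thesis by (rule that[OF eq _ \<open>\<not> 2 dvd - A * B\<close>]) (rule dvd_triv_left)
qed

text \<open>The value that the three initial terms dictate for
  \<open>c2 * (\<beta>2 - \<beta>1) * (\<beta>2 - \<beta>3)\<close>, in coordinates. Its conjugate
  \<open>E3\<close> plays the same role for \<open>c3\<close>.\<close>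

definition "E2 = elt (163 - 26 * b - 13 * s + 2 * b * s) (13 - 2 * b)"

lemma E2_eq: "E2 = 163 - 13 * (of_two_adic_int (2 * b) + \<beta>3) + of_two_adic_int (2 * b) * \<beta>3"
  by (simp add: E2_def elt_def \<beta>3_def algebra_simps)

definition "E3 = elt (163 - 26 * b - 13 * s + 2 * b * s) (2 * b - 13)"

lemma E3_eq: "E3 = 163 - 13 * (of_two_adic_int (2 * b) + \<beta>2) + of_two_adic_int (2 * b) * \<beta>2"
  by (simp add: E3_def elt_def \<beta>2_def algebra_simps)

text \<open>\<open>elt wa (2 * wb)\<close> is half of
  \<open>E2 * \<beta>2 * (\<beta>3 - \<beta>1)\<close>; it and its conjugate serve as numerator and
  denominator of \<open>- c2 * \<beta>2 / (c3 * \<beta>3)\<close>.\<close>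

definition "wa = 4 * (41 - 5 * h - 4 * h\<^sup>2) * (6 * h\<^sup>2 - 12 * h - 9) - u * (13 - 2 * b) * b"
definition "wb = (11 - 4 * h) * (6 * h\<^sup>2 - 12 * h - 9) - (41 - 5 * h - 4 * h\<^sup>2) * b"

lemma odd_wa: "\<not> 2 dvd wa"
proof -
  obtain v where v: "u = 1 + 2 * v" using odd_u by (rule odd_two_adic_intE)
  have "wa = 1 + 2 * (2 * (41 - 5 * h - 4 * h\<^sup>2) * (6 * h\<^sup>2 - 12 * h - 9)
      - 6 - 9 * h + 4 * h\<^sup>2 - v * (13 - 2 * b) * b)"
    unfolding wa_def v by (simp add: b_def power2_eq_square algebra_simps)
  thus ?thesis using odd_two_adic_intI by metis
qed

lemma E2_mult: "E2 * \<beta>2 * (\<beta>3 - of_two_adic_int (2 * b)) = 2 * elt wa (2 * wb)"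
proof -
  have "E2 * (elt s 1 * (elt s (- 1) - elt (2 * b) 0)) = elt (2 * wa) (2 * (2 * wb))"
    unfolding E2_def elt_mult elt_diff elt_eq_iff
    unfolding wa_def wb_def b_def s_def u_def by (simp add: power2_eq_square algebra_simps)
  thus ?thesis
    using pow2_mult_elt[of 1 wa "2 * wb"] by (simp add: \<beta>2_eq \<beta>3_eq of_two_adic_int_eq_elt mult.assoc del: of_two_adic_int_simps)
qed

lemma E3_mult: "E3 * \<beta>3 * (\<beta>2 - of_two_adic_int (2 * b)) = 2 * elt wa (- 2 * wb)"
proof -
  have "E3 * (elt s (- 1) * (elt s 1 - elt (2 * b) 0)) = elt (2 * wa) (2 * (- 2 * wb))"
    unfolding E3_def elt_mult elt_diff elt_eq_iff
    unfolding wa_def wb_def b_def s_def u_def by (simp add: power2_eq_square algebra_simps)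
  thus ?thesis
    using pow2_mult_elt[of 1 wa "- 2 * wb"] by (simp add: \<beta>2_eq \<beta>3_eq of_two_adic_int_eq_elt mult.assoc del: of_two_adic_int_simps)
qed

lemma odd_norm_w: "\<not> 2 dvd wa\<^sup>2 - u * (2 * wb)\<^sup>2"
proof -
  obtain v where v: "wa = 1 + 2 * v" using odd_wa by (rule odd_two_adic_intE)
  have "wa\<^sup>2 - u * (2 * wb)\<^sup>2 = 1 + 2 * (2 * v + 2 * v\<^sup>2 - 2 * u * wb\<^sup>2)"
    unfolding v by (simp add: power2_eq_square algebra_simps)
  thus ?thesis using odd_two_adic_intI by metis
qed

text \<open>The roots lie in \<open>OK\<close>, so the field \<open>F\<close> contains all
  generators; conversely \<delta>, which generates \<open>F\<close>, is \<open>\<beta>2\<close>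
  minus a 2-adic integer.\<close>

lemma splitting_field_cubic:
  assumes "cubic = [:- of_two_adic_int (2 * b), 1:] * [:- \<beta>2, 1:] * [:- \<beta>3, 1:]"
  shows "splitting_field (cubic :: two_adic poly) = F"
proof -
  let ?S = "range to_ac \<union> {x. poly (map_poly to_ac (cubic :: two_adic poly)) x = 0}"
  have map: "map_poly to_ac (cubic :: two_adic poly) = cubic"
    by (simp add: cubic_def map_poly_pCons)
  have roots: "poly (map_poly to_ac (cubic :: two_adic poly)) x
      = (x - of_two_adic_int (2 * b)) * (x - \<beta>2) * (x - \<beta>3)" for x
    unfolding map assms by (simp add: algebra_simps)
  have "splitting_field (cubic :: two_adic poly) \<subseteq> F"
    unfolding splitting_field_def
  proof (rule hull_minimal)
    have "of_two_adic_int (2 * b) \<in> F" "\<beta>2 \<in> F" "\<beta>3 \<in> F"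
      by (rule OK_in_F; simp only: \<beta>2_eq \<beta>3_eq elt_in_OK of_in_OK)+
    thus "?S \<subseteq> F" using range_to_ac_subset_F by (auto simp only: roots mult_eq_0_iff right_minus_eq)
  qed (rule F_is_subfield)
  moreover have "F \<subseteq> splitting_field (cubic :: two_adic poly)"
  proof
    define K where "K = splitting_field (cubic :: two_adic poly)"
    have "is_subfield K" unfolding K_def splitting_field_def
      by (rule hull_in) (auto simp: is_subfield_def)
    hence K: "0 \<in> K" "1 \<in> K" "\<And>x y. x \<in> K \<Longrightarrow> y \<in> K \<Longrightarrow> x + y \<in> K" "\<And>x y. x \<in> K \<Longrightarrow> y \<in> K \<Longrightarrow> x * y \<in> K"
      "\<And>x. x \<in> K \<Longrightarrow> - x \<in> K" "\<And>x. x \<in> K \<Longrightarrow> inverse x \<in> K"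
      by (auto simp: is_subfield_def)
    have "?S \<subseteq> K" unfolding K_def splitting_field_def by (rule hull_subset)
    hence in_K: "of_two_adic_int a \<in> K" "\<beta>2 \<in> K" for a
      by (auto simp: of_two_adic_int_def roots)
    fix z assume "z \<in> F"
    then obtain a c n where z: "z = elt a c / 2 ^ n" by (auto simp: F_def)
    have "\<delta> = \<beta>2 + - of_two_adic_int s" by (simp add: \<beta>2_def)
    also have "\<dots> \<in> K" by (rule K(3)[OF in_K(2) K(5)[OF in_K(1)]])
    finally have "elt a c \<in> K" unfolding elt_def by (rule K(3)[OF in_K(1) K(4)[OF in_K(1)]])
    moreover have "inverse (of_two_adic_int (2 ^ n)) \<in> K" by (rule K(6)[OF in_K(1)])
    ultimately have "elt a c * inverse (of_two_adic_int (2 ^ n)) \<in> K" by (rule K(4))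
    thus "z \<in> splitting_field cubic" by (simp add: z field_simps flip: K_def)
  qed
  ultimately show ?thesis by blast
qed

end

text \<open>Combining the three equations with the coefficients of
  \<open>(X - x2) * (X - x3)\<close> kills the terms of \<open>y\<close> and
  \<open>z\<close>.\<close>

lemma interpolation_coefficient:
  fixes x y z x1 x2 x3 :: "'a :: comm_ring_1"
  assumes "x + y + z = 1" "x * x1 + y * x2 + z * x3 = 13" "x * x1\<^sup>2 + y * x2\<^sup>2 + z * x3\<^sup>2 = 163"
  shows "x * ((x1 - x2) * (x1 - x3)) = 163 - 13 * (x2 + x3) + x2 * x3"
proof -
  have "163 - 13 * (x2 + x3) + x2 * x3 = (x * x1\<^sup>2 + y * x2\<^sup>2 + z * x3\<^sup>2)
      - (x * x1 + y * x2 + z * x3) * (x2 + x3) + (x + y + z) * (x2 * x3)"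
    by (simp only: assms mult_1_left)
  thus ?thesis by (simp add: power2_eq_square algebra_simps)
qed

locale cubic_recurrence = cubic_roots +
  fixes U :: "nat \<Rightarrow> int" and c1 c2 c3 :: "two_adic alg_closure"
  assumes U_init: "U 0 = 1" "U 1 = 13" "U 2 = 163"
    and U_eq: "\<And>i. of_int (U i) = c1 * of_two_adic_int (2 * b) ^ i + c2 * \<beta>2 ^ i + c3 * \<beta>3 ^ i"
begin

abbreviation "\<beta>1 \<equiv> of_two_adic_int (2 * b)"

lemma coefficient_sums:
  "c1 + c2 + c3 = 1" "c1 * \<beta>1 + c2 * \<beta>2 + c3 * \<beta>3 = 13" "c1 * \<beta>1\<^sup>2 + c2 * \<beta>2\<^sup>2 + c3 * \<beta>3\<^sup>2 = 163"
  using U_eq[of 0] U_eq[of 1] U_eq[of 2] by (simp_all add: U_init U_init(2)[simplified])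

text \<open>Half the derivative of the cubic at \<open>\<beta>1\<close>. It is odd, so multiplying
  by the derivative shifts valuations by exactly one.\<close>

definition "D' = 2 * b\<^sup>2 - 2 * s * b + p"
definition "e1 = 163 - 26 * s + 2 * p"

lemma odd_D': "\<not> 2 dvd D'"
proof -
  obtain v where v: "p = 1 + 2 * v" using odd_p by (rule odd_two_adic_intE)
  have "D' = 1 + 2 * (b\<^sup>2 - s * b + v)" unfolding D'_def v by simp
  thus ?thesis using odd_two_adic_intI by metis
qed

lemma \<beta>2_\<beta>3: "\<beta>2 + \<beta>3 = of_two_adic_int (2 * s)" "\<beta>2 * \<beta>3 = of_two_adic_int (2 * p)"
proof -
  have "\<beta>2 * \<beta>3 = of_two_adic_int (s\<^sup>2 - u)"
    using elt_conj_mult[of s 1] by (simp add: \<beta>2_eq \<beta>3_eq)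
  thus "\<beta>2 * \<beta>3 = of_two_adic_int (2 * p)" unfolding u_eq by simp
qed (simp add: \<beta>2_def \<beta>3_def)

lemma D'_eq: "of_two_adic_int (2 * D') = (\<beta>1 - \<beta>2) * (\<beta>1 - \<beta>3)"
proof -
  have "(\<beta>1 - \<beta>2) * (\<beta>1 - \<beta>3) = \<beta>1\<^sup>2 - (\<beta>2 + \<beta>3) * \<beta>1 + \<beta>2 * \<beta>3"
    by (simp add: power2_eq_square algebra_simps)
  thus ?thesis unfolding \<beta>2_\<beta>3 D'_def by (simp add: power2_eq_square algebra_simps)
qed

lemma c1_eq: "of_two_adic_int (2 * D') * c1 = of_two_adic_int e1"
proof -
  have "c1 * ((\<beta>1 - \<beta>2) * (\<beta>1 - \<beta>3)) = 163 - 13 * (\<beta>2 + \<beta>3) + \<beta>2 * \<beta>3"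
    by (rule interpolation_coefficient[OF coefficient_sums])
  thus ?thesis unfolding D'_eq \<beta>2_\<beta>3 e1_def by (simp add: mult.commute)
qed

lemma c2_eq: "c2 * (\<beta>2 - \<beta>1) * (2 * \<delta>) = E2"
proof -
  have "c2 * ((\<beta>2 - \<beta>1) * (\<beta>2 - \<beta>3)) = 163 - 13 * (\<beta>1 + \<beta>3) + \<beta>1 * \<beta>3"
    by (rule interpolation_coefficient[of _ c1 c3]) (use coefficient_sums in \<open>simp_all add: add_ac\<close>)
  moreover have "\<beta>2 - \<beta>3 = 2 * \<delta>" by (simp add: \<beta>2_def \<beta>3_def)
  ultimately show ?thesis by (simp add: E2_eq mult.assoc)
qed

lemma c3_eq: "c3 * (\<beta>3 - \<beta>1) * (2 * \<delta>) = - E3"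
proof -
  have "c3 * ((\<beta>3 - \<beta>1) * (\<beta>3 - \<beta>2)) = 163 - 13 * (\<beta>1 + \<beta>2) + \<beta>1 * \<beta>2"
    by (rule interpolation_coefficient[of _ c1 c2]) (use coefficient_sums in \<open>simp_all add: add_ac\<close>)
  also have "\<dots> = E3" by (simp only: E3_eq)
  also have "\<beta>3 - \<beta>2 = - (2 * \<delta>)" by (simp add: \<beta>2_def \<beta>3_def)
  finally show ?thesis by (simp only: mult_minus_right mult.assoc) (metis minus_minus)
qed

lemma w_neq_0: "elt wa (2 * wb) \<noteq> 0" "elt wa (- 2 * wb) \<noteq> 0"
  using odd_wa by (auto simp: elt_eq_0_iff)

lemma c3_nonzero: "c3 \<noteq> 0"
  using c3_eq E3_mult w_neq_0 by auto

definition "y = - (c2 * \<beta>2) / (c3 * \<beta>3)"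

lemma c2_y: "c2 * \<beta>2 = - y * (c3 * \<beta>3)"
  using c3_nonzero \<beta>_nonzero by (simp add: y_def)

lemma y_mult: "y * elt wa (- 2 * wb) = elt wa (2 * wb)"
proof -
  have "y * (2 * elt wa (- 2 * wb)) = y * ((- c3 * (\<beta>3 - \<beta>1) * (2 * \<delta>)) * \<beta>3 * (\<beta>2 - \<beta>1))"
    using c3_eq E3_mult by simp
  also have "\<dots> = (- y * (c3 * \<beta>3)) * ((\<beta>3 - \<beta>1) * (2 * \<delta>) * (\<beta>2 - \<beta>1))" by (simp add: mult_ac)
  also have "\<dots> = (c2 * (\<beta>2 - \<beta>1) * (2 * \<delta>)) * \<beta>2 * (\<beta>3 - \<beta>1)"
    unfolding c2_y[symmetric] by (simp only: mult_ac)
  also have "\<dots> = 2 * elt wa (2 * wb)" using c2_eq E2_mult by simp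
  finally show ?thesis by simp
qed

text \<open>\<open>y\<close> is a quotient of conjugates with \<delta>-coordinates
  \<open>2 * wb\<close> and \<open>- 2 * wb\<close>. Their difference is divisible by 4, and the
  denominator is a unit.\<close>

lemma y_minus_1: "pdvd 2 (y - 1)"
proof -
  have "(y - 1) * elt wa (- 2 * wb) = 4 * elt 0 wb"
    using y_mult by (simp add: elt_def algebra_simps)
  moreover have "pdvd 2 (4 * elt 0 wb)" by (auto simp: pdvd_def)
  moreover have "\<not> 2 dvd wa\<^sup>2 - u * (- 2 * wb)\<^sup>2" using odd_norm_w by simp
  ultimately show ?thesis by (metis pdvd_mult_elt_odd_norm)
qed

text \<open>\<open>T\<close> removes the contribution of \<open>\<beta>1\<close>; the factor \<open>P'(\<beta>1) = 2 * D'\<close> clears the denominator of \<open>c1\<close>.\<close>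

definition "T i = 2 * D' * of_int (U i) - e1 * (2 * b) ^ i"

text \<open>Pull \<open>c3 * \<beta>3 * \<beta>2 ^ (4 * k)\<close> out of the terms of
  \<open>\<beta>2\<close> and \<open>\<beta>3\<close>. The factor \<delta> clears the denominator of
  \<open>c3\<close>; besides \<open>2 ^ (2 * k)\<close> and the difference with \<open>y\<close>,
  only units remain on the right.\<close>

lemma T_eq:
  "of_two_adic_int (T (4 * k + 1)) * \<delta>
   = 2 ^ (2 * k) * ((y - ((\<beta>3 / \<beta>2) ^ 4) ^ k) * elt wa (- 2 * wb) * elt g s ^ (2 * k))"
proof -
  let ?i = "4 * k + 1" and ?x = "(\<beta>3 / \<beta>2) ^ 4"
  have "of_two_adic_int (T ?i) = of_two_adic_int (2 * D') * of_int (U ?i) - of_two_adic_int e1 * \<beta>1 ^ ?i"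
    by (simp add: T_def)
  also have "\<dots> = of_two_adic_int (2 * D') * (c2 * \<beta>2 ^ ?i + c3 * \<beta>3 ^ ?i)"
    unfolding c1_eq[symmetric] U_eq by (simp add: algebra_simps del: of_two_adic_int_simps)
  also have "c2 * \<beta>2 ^ ?i + c3 * \<beta>3 ^ ?i = \<beta>2 ^ (4 * k) * (?x ^ k - y) * (c3 * \<beta>3)"
  proof -
    have "c2 * \<beta>2 ^ ?i = - y * (c3 * \<beta>3) * \<beta>2 ^ (4 * k)"
      unfolding c2_y[symmetric] by (simp add: mult_ac)
    moreover have "\<beta>3 ^ (4 * k) = \<beta>2 ^ (4 * k) * ?x ^ k"
      using \<beta>_nonzero by (simp add: power_divide flip: power_mult)
    hence "c3 * \<beta>3 ^ ?i = c3 * \<beta>3 * (\<beta>2 ^ (4 * k) * ?x ^ k)" by simp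
    ultimately show ?thesis by (simp only:) (simp add: algebra_simps)
  qed
  also have "\<beta>2 ^ (4 * k) = 2 ^ (2 * k) * elt g s ^ (2 * k)"
  proof -
    have "\<beta>2 ^ (4 * k) = (\<beta>2\<^sup>2) ^ (2 * k)" by (simp flip: power_mult)
    thus ?thesis unfolding \<beta>2_square by (simp only: power_mult_distrib)
  qed
  finally have "of_two_adic_int (T ?i) * \<delta> = 2 ^ (2 * k) * ((?x ^ k - y) *
      (of_two_adic_int (2 * D') * (c3 * \<beta>3) * \<delta>) * elt g s ^ (2 * k))"
    by (simp add: mult_ac)
  also have "of_two_adic_int (2 * D') * (c3 * \<beta>3) * \<delta> = - elt wa (- 2 * wb)"
  proof -
    have "2 * (of_two_adic_int (2 * D') * (c3 * \<beta>3) * \<delta>)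
        = (c3 * (\<beta>3 - \<beta>1) * (2 * \<delta>)) * \<beta>3 * (\<beta>2 - \<beta>1)"
      unfolding D'_eq by (simp add: algebra_simps del: of_two_adic_int_simps)
    also have "\<dots> = 2 * (- elt wa (- 2 * wb))" unfolding c3_eq using E3_mult by simp
    finally show ?thesis by (rule iffD1[OF mult_left_cancel[OF ac_numeral_neq_0]])
  qed
  finally show ?thesis by (simp add: algebra_simps)
qed

lemma pow2_dvd_T_iff:
  "2 ^ (2 * k + m) dvd T (4 * k + 1) \<longleftrightarrow> pdvd m (y - ((\<beta>3 / \<beta>2) ^ 4) ^ k)"
proof -
  have "\<not> 2 dvd 0\<^sup>2 - u * 1\<^sup>2" using odd_u by simp
  hence 1: "pdvd n (z * \<delta>) \<longleftrightarrow> pdvd n z" for n z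
    using pdvd_mult_elt_odd_norm[of 0 1 n z] by (simp add: elt_def)
  have 2: "\<not> 2 dvd wa\<^sup>2 - u * (- 2 * wb)\<^sup>2" using odd_norm_w by simp
  have 3: "\<not> 2 dvd g\<^sup>2 - u * s\<^sup>2" unfolding norm_g_s using odd_p by (rule two_adic_odd_power)
  have 4: "pdvd n (z * elt g s ^ j) \<longleftrightarrow> pdvd n z" for n z j
    by (induction j) (simp_all add: mult.assoc[symmetric] power_Suc2 pdvd_mult_elt_odd_norm[OF 3] del: power_Suc)
  have "2 ^ (2 * k + m) dvd T (4 * k + 1) \<longleftrightarrow> pdvd (2 * k + m) (of_two_adic_int (T (4 * k + 1)) * \<delta>)"
    unfolding 1 pdvd_of_two_adic_int_iff ..
  also have "\<dots> \<longleftrightarrow> pdvd m (y - ((\<beta>3 / \<beta>2) ^ 4) ^ k)"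
    unfolding T_eq pdvd_pow2_mult 4 pdvd_mult_elt_odd_norm[OF 2] ..
  finally show ?thesis .
qed

text \<open>The 2 in \<open>2 * D'\<close> accounts for the \<open>Suc\<close> of
  \<open>pdvd_diff_power_iff\<close>. The bound on \<open>m\<close> makes the term of
  \<open>\<beta>1\<close>, divisible by \<open>2 ^ (4 * k + 1)\<close>, vanish modulo
  \<open>2 ^ (2 * k + Suc m)\<close>.\<close>

lemma pow2_dvd_U_iff:
  fixes \<zeta> :: two_adic_int
  assumes zeta: "of_two_adic_int \<zeta> = 1 + 4 / log2_adic F ((\<beta>3 / \<beta>2) ^ 4) * log2_adic F y"
    and m: "m \<le> 2 * k"
  shows "2 ^ (2 * k + m) dvd U (4 * k + 1) \<longleftrightarrow> 2 ^ m dvd \<zeta> - of_nat (4 * k + 1)"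
proof -
  obtain a c where ac: "(\<beta>3 / \<beta>2) ^ 4 - 1 = 8 * elt a c" "2 dvd a" "\<not> 2 dvd c"
    using ratio_power_4 .
  have "pdvd 2 ((\<beta>3 / \<beta>2) ^ 4 - 1)"
    unfolding ac(1) pdvd_def by (rule bexI[of _ "2 * elt a c"]) auto
  hence "2 ^ m dvd \<zeta> - of_nat (4 * k + 1) \<longleftrightarrow> pdvd (Suc m) (y - ((\<beta>3 / \<beta>2) ^ 4) ^ k)"
    using pdvd_diff_power_iff[OF _ ac y_minus_1 zeta] by blast
  also have "\<dots> \<longleftrightarrow> 2 ^ (2 * k + Suc m) dvd T (4 * k + 1)" by (rule pow2_dvd_T_iff[symmetric])
  also have "\<dots> \<longleftrightarrow> 2 ^ (2 * k + Suc m) dvd 2 * D' * of_int (U (4 * k + 1))"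
  proof -
    have "2 ^ (2 * k + Suc m) dvd (2 :: two_adic_int) ^ (4 * k + 1)"
      using m by (intro le_imp_power_dvd) simp
    hence "2 ^ (2 * k + Suc m) dvd e1 * (2 * b) ^ (4 * k + 1)"
      by (metis dvd_mult dvd_mult2 power_mult_distrib)
    thus ?thesis unfolding T_def by (metis diff_add_cancel dvd_add dvd_diff)
  qed
  also have "2 * D' * of_int (U (4 * k + 1)) = 2 * (of_int (U (4 * k + 1)) * D')" by (simp only: mult_ac)
  also have "2 ^ (2 * k + Suc m) dvd \<dots> \<longleftrightarrow> 2 ^ (2 * k + m) dvd of_int (U (4 * k + 1)) * D'"
    using two_adic_2_neq_0 by simp
  also have "\<dots> \<longleftrightarrow> 2 ^ (2 * k + m) dvd U (4 * k + 1)"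
    unfolding pow2_dvd_mult_odd[OF odd_D'] by (rule pow2_dvd_of_int)
  finally show ?thesis ..
qed

end

section \<open>Valuations of the recurrence\<close>

lemma multiplicity_2_pow2_mult_odd: "odd a \<Longrightarrow> multiplicity 2 (2 ^ n * a :: int) = n"
  by (rule multiplicity_eqI) auto

lemma recurrence_shift:
  fixes U :: "nat \<Rightarrow> int"
  assumes "\<And>i. U (i + 3) = 12 * U (i + 2) + 6 * U (i + 1) + 12 * U i"
    and "n = i + 3" "l = i + 2" "k = i + 1"
  shows "U n = 12 * U l + 6 * U k + 12 * U i"
  using assms by simp

text \<open>Parities propagate: modulo 2 the next \<open>b\<close> is \<open>a + b\<close>, hence
  alternates, and the next \<open>c\<close> is \<open>c\<close>. Odd \<open>n\<close> belongs to the
  indices \<open>2 * n + 3\<close> that are 1 modulo 4, where this gives only that \<open>b\<close>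
  is even.\<close>

lemma recurrence_factorization:
  fixes U :: "nat \<Rightarrow> int"
  assumes U_init: "U 0 = 1" "U 1 = 13" "U 2 = 163"
    and U_rec: "\<And>i. U (i + 3) = 12 * U (i + 2) + 6 * U (i + 1) + 12 * U i"
  shows "\<exists>a b c. U (2 * n + 2) = 2 ^ n * a \<and> U (2 * n + 3) = 2 ^ Suc n * b \<and>
    U (2 * n + 4) = 2 ^ Suc n * c \<and> odd a \<and> odd c \<and> (odd b \<longleftrightarrow> even n)"
proof (induction n)
  case 0
  have "U 3 = 2046" using recurrence_shift[of U, OF U_rec, of 3 0 2 1] U_init by simp
  moreover from this have "U 4 = 25686" using recurrence_shift[of U, OF U_rec, of 4 1 3 2] U_init by simp
  ultimately show ?case
    using U_init(3) by - (rule exI[of _ 163], rule exI[of _ 1023], rule exI[of _ 12843], simp add: numeral_2_eq_2)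
next
  case (Suc n)
  then obtain a b c where abc: "U (2 * n + 2) = 2 ^ n * a" "U (2 * n + 3) = 2 ^ Suc n * b"
    "U (2 * n + 4) = 2 ^ Suc n * c" "odd a" "odd c" "odd b \<longleftrightarrow> even n" by blast
  have "U (2 * n + 5) = 12 * U (2 * n + 4) + 6 * U (2 * n + 3) + 12 * U (2 * n + 2)"
    by (rule recurrence_shift[of U, OF U_rec]) simp_all
  also have "\<dots> = 2 ^ Suc (Suc n) * (6 * c + 3 * b + 3 * a)"
    unfolding abc(1-3) by (simp add: algebra_simps)
  finally have U5: "U (2 * n + 5) = 2 ^ Suc (Suc n) * (6 * c + 3 * b + 3 * a)" .
  have "U (2 * n + 6) = 12 * U (2 * n + 5) + 6 * U (2 * n + 4) + 12 * U (2 * n + 3)"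
    by (rule recurrence_shift[of U, OF U_rec]) simp_all
  also have "\<dots> = 2 ^ Suc (Suc n) * (12 * (6 * c + 3 * b + 3 * a) + 3 * c + 6 * b)"
    unfolding U5 abc(1-3) by (simp add: algebra_simps)
  finally have U6: "U (2 * n + 6) = 2 ^ Suc (Suc n) * (12 * (6 * c + 3 * b + 3 * a) + 3 * c + 6 * b)" .
  have "2 * Suc n + 2 = 2 * n + 4" "2 * Suc n + 3 = 2 * n + 5" "2 * Suc n + 4 = 2 * n + 6" by simp_all
  thus ?case using U5 U6 abc
    by - (rule exI[of _ c], rule exI[of _ "6 * c + 3 * b + 3 * a"],
        rule exI[of _ "12 * (6 * c + 3 * b + 3 * a) + 3 * c + 6 * b"], simp only:, simp)
qed

lemma recurrence_values:
  fixes U :: "nat \<Rightarrow> int"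
  assumes U_init: "U 0 = 1" "U 1 = 13" "U 2 = 163"
    and U_rec: "\<And>i. U (i + 3) = 12 * U (i + 2) + 6 * U (i + 1) + 12 * U i"
  shows "U 13 = 198956543963904" "U 17 = 4941931769376897024"
proof -
  have U3: "U 3 = 2046"
    by (subst recurrence_shift[of U, OF U_rec, of 3 0 2 1]) (simp_all add: U_init(1) U_init(2)[simplified] U_init(3))
  have U4: "U 4 = 25686"
    by (subst recurrence_shift[of U, OF U_rec, of 4 1 3 2]) (simp_all add: U_init(2)[simplified] U_init(3) U3)
  have U5: "U 5 = 322464"
    by (subst recurrence_shift[of U, OF U_rec, of 5 2 4 3]) (simp_all add: U_init(3) U3 U4)
  have U6: "U 6 = 4048236"
    by (subst recurrence_shift[of U, OF U_rec, of 6 3 5 4]) (simp_all add: U3 U4 U5)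
  have U7: "U 7 = 50821848"
    by (subst recurrence_shift[of U, OF U_rec, of 7 4 6 5]) (simp_all add: U4 U5 U6)
  have U8: "U 8 = 638021160"
    by (subst recurrence_shift[of U, OF U_rec, of 8 5 7 6]) (simp_all add: U5 U6 U7)
  have U9: "U 9 = 8009763840"
    by (subst recurrence_shift[of U, OF U_rec, of 9 6 8 7]) (simp_all add: U6 U7 U8)
  have U10: "U 10 = 100555155216"
    by (subst recurrence_shift[of U, OF U_rec, of 10 7 9 8]) (simp_all add: U7 U8 U9)
  have U11: "U 11 = 1262376699552"
    by (subst recurrence_shift[of U, OF U_rec, of 11 8 10 9]) (simp_all add: U8 U9 U10)
  have U12: "U 12 = 15847968492000"
    by (subst recurrence_shift[of U, OF U_rec, of 12 9 11 10]) (simp_all add: U9 U10 U11)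
  have U13: "U 13 = 198956543963904"
    by (subst recurrence_shift[of U, OF U_rec, of 13 10 12 11]) (simp_all add: U10 U11 U12)
  have U14: "U 14 = 2497714858913472"
    by (subst recurrence_shift[of U, OF U_rec, of 14 11 13 12]) (simp_all add: U11 U12 U13)
  have U15: "U 15 = 31356493192649088"
    by (subst recurrence_shift[of U, OF U_rec, of 15 12 14 13]) (simp_all add: U12 U13 U14)
  have U16: "U 16 = 393651685992836736"
    by (subst recurrence_shift[of U, OF U_rec, of 16 13 15 14]) (simp_all add: U13 U14 U15)
  have U17: "U 17 = 4941931769376897024"
    by (subst recurrence_shift[of U, OF U_rec, of 17 14 16 15]) (simp_all add: U14 U15 U16)
  show "U 13 = 198956543963904" "U 17 = 4941931769376897024" by (rule U13 U17)+
qed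

text \<open>The digits of \<open>i\<close> vanish from position \<open>a\<close> on, and
  \<open>x\<close> shares its digits with \<open>i\<close> below position \<open>n\<close>.\<close>

lemma zero_block_length_ge:
  assumes "2 ^ n dvd x - of_nat i" "i < 2 ^ a"
  shows "enat (n - a) \<le> zero_block_length x a"
proof -
  have "digit x (a + j) = 0" if "j < n - a" for j
  proof -
    have "2 ^ Suc (a + j) dvd x - of_nat i"
      using that by (intro dvd_trans[OF le_imp_power_dvd assms(1)]) simp
    hence "residue x (Suc (a + j)) = int i mod 2 ^ Suc (a + j)"
      by (simp only: residue_eq_iff[symmetric] residue_of_nat)
    moreover have "i < 2 ^ (a + j)"
      by (rule less_le_trans[OF assms(2)]) simp
    hence "int i < 2 ^ (a + j)" by (metis of_nat_less_iff of_nat_numeral of_nat_power)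
    ultimately show ?thesis by (simp add: digit_def)
  qed
  thus ?thesis unfolding zero_block_length_def by (intro SUP_upper) simp
qed

theorem theorem6p5:
  fixes U :: "nat \<Rightarrow> int"
    and \<beta>1 \<zeta> :: two_adic_int
    and K :: "two_adic alg_closure set"
    and \<beta>2 \<beta>3 c1 c2 c3 L :: "two_adic alg_closure"
  assumes U_init: "U 0 = 1" "U 1 = 13" "U 2 = 163"
    and U_rec: "\<And>i. U (i + 3) = 12 * U (i + 2) + 6 * U (i + 1) + 12 * U i"
    and beta1: "poly cubic \<beta>1 = 0" "4 dvd \<beta>1 - 2"
    and K: "K = splitting_field cubic"
    and beta23: "cubic = [:- of_two_adic_int \<beta>1, 1:] * [:- \<beta>2, 1:] * [:- \<beta>3, 1:]"
    and c_in_K: "c1 \<in> K" "c2 \<in> K" "c3 \<in> K"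
    and U_eq: "\<And>i. of_int (U i) = c1 * of_two_adic_int \<beta>1 ^ i + c2 * \<beta>2 ^ i + c3 * \<beta>3 ^ i"
    and L: "L = log2_adic K ((\<beta>3 / \<beta>2) ^ 4)"
    and zeta: "of_two_adic_int \<zeta> = 1 + 4 / L * log2_adic K (- (c2 * \<beta>2) / (c3 * \<beta>3))"
    and blocks: "\<And>a. ereal_of_enat (zero_block_length \<zeta> a) \<le> ereal (2 / 95 * real a + 18 / 5)"
  shows "\<forall>i\<ge>10. enat (multiplicity 2 (U i)) =
           enat ((i - 1) div 2) + (if i mod 4 = 1 then nu2 (of_nat i - \<zeta>) else 0)"
proof (intro allI impI)
  fix i :: nat assume i: "i \<ge> 10"
  obtain h where "\<beta>1 - 2 = 4 * h" using beta1(2) by (elim dvdE)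
  hence h: "\<beta>1 = 2 * (1 + 2 * h)" by (simp add: algebra_simps)
  define s where "s = 5 - 2 * h"
  define \<delta> where "\<delta> = \<beta>2 - of_two_adic_int s"
  have coeffs: "\<beta>2 + \<beta>3 = 12 - of_two_adic_int \<beta>1"
    "\<beta>2 * \<beta>3 = - 6 - of_two_adic_int \<beta>1 * (\<beta>2 + \<beta>3)"
    using beta23 by (auto simp: cubic_def algebra_simps)
  have sum: "\<beta>2 + \<beta>3 = of_two_adic_int (2 * s)"
    unfolding coeffs h s_def by (simp add: algebra_simps)
  have prod: "\<beta>2 * \<beta>3 = of_two_adic_int (- 6 - 2 * (1 + 2 * h) * (2 * s))"
    unfolding coeffs(2) sum h by simp
  have \<beta>3: "\<beta>3 = of_two_adic_int s - \<delta>"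
    using sum by (simp add: \<delta>_def algebra_simps)
  have \<beta>2: "\<beta>2 = of_two_adic_int s + \<delta>" by (simp add: \<delta>_def)
  have "\<delta>\<^sup>2 = of_two_adic_int (s\<^sup>2) - \<beta>2 * \<beta>3"
    unfolding \<beta>3 \<beta>2 by (simp add: power2_eq_square algebra_simps)
  also have "\<dots> = of_two_adic_int (51 + 12 * h - 12 * h\<^sup>2)"
    unfolding prod s_def of_two_adic_int_simps(4)[symmetric] of_two_adic_int_eq_iff
    by (simp add: power2_eq_square algebra_simps)
  finally have \<delta>_square: "\<delta>\<^sup>2 = of_two_adic_int (51 + 12 * h - 12 * h\<^sup>2)" .
  interpret R: cubic_roots h \<delta>
    by standard (rule \<delta>_square)
  have R: "R.b = 1 + 2 * h" "R.\<beta>2 = \<beta>2" "R.\<beta>3 = \<beta>3"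
    by (simp_all add: R.b_def R.\<beta>2_def R.\<beta>3_def R.s_def \<beta>2 \<beta>3 s_def)
  interpret R: cubic_recurrence h \<delta> U c1 c2 c3
    by standard (use U_init U_eq in \<open>simp_all only: R h\<close>)
  have "K = R.F"
    unfolding K by (rule R.splitting_field_cubic) (use beta23 in \<open>simp only: R h\<close>)
  hence zeta': "of_two_adic_int \<zeta> = 1 + 4 / log2_adic R.F ((R.\<beta>3 / R.\<beta>2) ^ 4) * log2_adic R.F R.y"
    using zeta by (simp add: L R R.y_def)
  note dvd_iff = R.pow2_dvd_U_iff[OF zeta']
  show "enat (multiplicity 2 (U i)) =
      enat ((i - 1) div 2) + (if i mod 4 = 1 then nu2 (of_nat i - \<zeta>) else 0)"
  proof (cases "i mod 4 = 1")
    case True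
    define k where "k = i div 4"
    have i_eq: "i = 4 * k + 1" and k: "k \<ge> 3"
      using True i by (auto simp: k_def) presburger+
    \<comment> \<open>This keeps the valuation \<open>n\<close> of \<open>i - \<zeta>\<close>, and
      also \<open>Suc n\<close>, within the range where \<open>dvd_iff\<close> applies.\<close>
    have bound: "\<not> 2 ^ (2 * k) dvd \<zeta> - of_nat i"
    proof
      assume dvd: "2 ^ (2 * k) dvd \<zeta> - of_nat i"
      hence "2 ^ (2 * k + 2 * k) dvd U (4 * k + 1)" using dvd_iff[of "2 * k" k] i_eq by simp
      hence U_dvd: "2 ^ (4 * k) dvd U (4 * k + 1)" by simp
      consider "k = 3" | "k = 4" | "k \<ge> 5" using k by linarith
      thus False
      proof cases
        case 3
        \<comment> \<open>This fails for 13 and 17, which exceed \<open>2 ^ 3\<close> and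
          \<open>2 ^ 4\<close>. It yields a block of at least \<open>k\<close> zeros from position
          \<open>k\<close>, whereas the assumed bound \<open>2 / 95 * k + 18 / 5\<close> is below
          \<open>k\<close>.\<close>
        have "4 * k + 1 < 2 ^ k"
          using 3 by (induction k rule: dec_induct) simp_all
        hence "enat (2 * k - k) \<le> zero_block_length \<zeta> k"
          using dvd i_eq by (intro zero_block_length_ge) simp_all
        hence "ereal_of_enat (enat (2 * k - k)) \<le> ereal_of_enat (zero_block_length \<zeta> k)"
          by (simp only: ereal_of_enat_le_iff)
        also note blocks[of k]
        finally have "real k \<le> 2 / 95 * real k + 18 / 5" by simp
        thus False using 3 by simp
      next
        \<comment> \<open>The two small cases are settled by explicit values: \<open>2 ^ 12\<close>
          does not divide \<open>U 13\<close>, and \<open>2 ^ 16\<close> does not divide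
          \<open>U 17\<close>.\<close>
        case 1
        thus ?thesis using U_dvd recurrence_values(1)[OF U_init U_rec] by simp
      next
        case 2
        thus ?thesis using U_dvd recurrence_values(2)[OF U_init U_rec] by simp
      qed
    qed
    hence "\<not> 2 ^ (2 * k) dvd of_nat i - \<zeta>" by (metis dvd_minus_iff minus_diff_eq)
    moreover from this have "of_nat i - \<zeta> \<noteq> 0" by auto
    then obtain n v where v: "of_nat i - \<zeta> = 2 ^ n * v" "\<not> 2 dvd v" using two_adic_decomp by blast
    ultimately have n: "n < 2 * k" by (simp add: pow2_dvd_pow2_mult_odd_iff)
    have dvd: "2 ^ m dvd \<zeta> - of_nat i \<longleftrightarrow> m \<le> n" for m
      using pow2_dvd_pow2_mult_odd_iff[OF v(2), of m n] v(1) by (metis dvd_minus_iff minus_diff_eq)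
    have "multiplicity 2 (U i) = 2 * k + n"
      using dvd_iff[of n k] dvd_iff[of "Suc n" k] dvd[of n] dvd[of "Suc n"] n
      by (intro multiplicity_eqI) (simp_all add: i_eq)
    moreover have "nu2 (of_nat i - \<zeta>) = enat n" unfolding v(1) using v(2) by (rule nu2_decomp)
    ultimately show ?thesis using True by (simp add: i_eq)
  next
    case False
    show ?thesis
    proof (cases "even i")
      case True
      hence "i = 2 * ((i - 2) div 2) + 2" using i by presburger
      then obtain n where n: "i = 2 * n + 2" by blast
      then obtain a where "U i = 2 ^ n * a" "odd a"
        using recurrence_factorization[OF U_init U_rec, of n] by blast
      thus ?thesis using False by (simp add: multiplicity_2_pow2_mult_odd n)
    next
      case odd: False
      \<comment> \<open>An odd index that is not 1 modulo 4 is \<open>2 * n + 3\<close> with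
        \<open>n\<close> even, where the cofactor \<open>b\<close> is odd and
        \<open>(i - 1) div 2\<close> is \<open>Suc n\<close>.\<close>
      have "even ((i - 3) div 2)" "i = 2 * ((i - 3) div 2) + 3"
        using odd False i by presburger+
      then obtain n where n: "i = 2 * n + 3" "even n" by blast
      then obtain b where "U i = 2 ^ Suc n * b" "odd b"
        using recurrence_factorization[OF U_init U_rec, of n] by blast
      hence "multiplicity 2 (U i) = Suc n" using multiplicity_2_pow2_mult_odd[of b "Suc n"] by simp
      thus ?thesis using False by (simp add: n)
    qed
  qed
qed

end
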